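(* Let $\Omega$ be a simply connected proper subdomain of $\mathbb{C}$. Then there is a function $f \in \mathcal{B}_{l.u.}(\Omega)$ such that $\{ f \circ \phi : \phi \in \mathrm{Aut}(\Omega)\}$ is dense in $\mathcal{B}_{l.u.}(\Omega)$.
   Context: $\mathcal{B}_{l.u.}(\Omega)$ is the set of all holomorphic functions $f:\Omega\to\mathbb{C}$ with $|f(z)|\le 1$ and $f'(z)\neq 0$ for all $z\in\Omega$ (bounded locally univalent functions), equipped with the topology of locally uniform convergence on $\Omega$. $\mathrm{Aut}(\Omega)$ is the group of all conformal automorphisms (biholomorphic self-maps) of $\Omega$. *)

theory Defs
  imports "HOL-Complex_Analysis.Complex_Analysis"
begin

text \<open>
  A function \<open>\<Omega> \<rightarrow> \<complex>\<close> is represented by its extensional representative, which is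
  \<^const>\<open>undefined\<close> off \<open>\<Omega>\<close>, so that functions agreeing on \<open>\<Omega>\<close> are identified and the
  topology below is Hausdorff.

  The basic neighbourhoods are those of uniform convergence on compact subsets of \<open>\<Omega>\<close>;
  for open \<open>\<Omega>\<close> this is the topology of locally uniform convergence, see
  \<open>limitin_locally_uniform_topology_iff\<close> below.
\<close>

definition locally_uniform_topology :: "complex set \<Rightarrow> (complex \<Rightarrow> complex) topology" where
  "locally_uniform_topology \<Omega> = topology (\<lambda>U. U \<subseteq> extensional \<Omega> \<and>
     (\<forall>f\<in>U. \<exists>K e. compact K \<and> K \<subseteq> \<Omega> \<and> 0 < e \<and>
        {g \<in> extensional \<Omega>. \<forall>z\<in>K. dist (g z) (f z) < e} \<subseteq> U))"

definition bounded_loc_univalent :: "complex set \<Rightarrow> (complex \<Rightarrow> complex) set" where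
  "bounded_loc_univalent \<Omega> = {f \<in> extensional \<Omega>. f holomorphic_on \<Omega> \<and>
     (\<forall>z\<in>\<Omega>. norm (f z) \<le> 1 \<and> deriv f z \<noteq> 0)}"

definition bounded_loc_univalent_topology :: "complex set \<Rightarrow> (complex \<Rightarrow> complex) topology" where
  "bounded_loc_univalent_topology \<Omega> =
     subtopology (locally_uniform_topology \<Omega>) (bounded_loc_univalent \<Omega>)"

definition conformal_Aut :: "complex set \<Rightarrow> (complex \<Rightarrow> complex) set" where
  "conformal_Aut \<Omega> = {\<phi> \<in> extensional \<Omega>. \<phi> holomorphic_on \<Omega> \<and> bij_betw \<phi> \<Omega> \<Omega> \<and>
     inv_into \<Omega> \<phi> holomorphic_on \<Omega>}"

definition dense_subset_of :: "'a topology \<Rightarrow> 'a set \<Rightarrow> bool" where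
  "dense_subset_of X S \<longleftrightarrow> S \<subseteq> topspace X \<and> X closure_of S = topspace X"

lemma istopology_locally_uniform:
  "istopology (\<lambda>U. U \<subseteq> extensional \<Omega> \<and>
     (\<forall>f\<in>U. \<exists>K e. compact K \<and> K \<subseteq> \<Omega> \<and> 0 < e \<and>
        {g \<in> extensional \<Omega>. \<forall>z\<in>K. dist (g z) (f z :: complex) < e} \<subseteq> U))"
  (is "istopology ?P")
  unfolding istopology_def
proof (intro conjI allI impI)
  fix S T assume S: "?P S" and T: "?P T"
  show "S \<inter> T \<subseteq> extensional \<Omega>" using S by blast
  show "\<forall>f\<in>S \<inter> T. \<exists>K e. compact K \<and> K \<subseteq> \<Omega> \<and> 0 < e \<and>
      {g \<in> extensional \<Omega>. \<forall>z\<in>K. dist (g z) (f z) < e} \<subseteq> S \<inter> T"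
  proof
    fix f assume f: "f \<in> S \<inter> T"
    obtain K e where K: "compact K" "K \<subseteq> \<Omega>" "0 < e"
        "{g \<in> extensional \<Omega>. \<forall>z\<in>K. dist (g z) (f z) < e} \<subseteq> S"
      using S f by blast
    obtain L d where L: "compact L" "L \<subseteq> \<Omega>" "0 < d"
        "{g \<in> extensional \<Omega>. \<forall>z\<in>L. dist (g z) (f z) < d} \<subseteq> T"
      using T f by blast
    have "compact (K \<union> L)" "K \<union> L \<subseteq> \<Omega>" "0 < min e d"
      using K L by auto
    moreover have "{g \<in> extensional \<Omega>. \<forall>z\<in>K \<union> L. dist (g z) (f z) < min e d} \<subseteq> S \<inter> T"
      using K(4) L(4) by auto
    ultimately show "\<exists>K e. compact K \<and> K \<subseteq> \<Omega> \<and> 0 < e \<and>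
        {g \<in> extensional \<Omega>. \<forall>z\<in>K. dist (g z) (f z) < e} \<subseteq> S \<inter> T" by blast
  qed
next
  fix \<K> assume *: "\<forall>S\<in>\<K>. ?P S"
  then show "\<Union>\<K> \<subseteq> extensional \<Omega>" by blast
  show "\<forall>f\<in>\<Union>\<K>. \<exists>K e. compact K \<and> K \<subseteq> \<Omega> \<and> 0 < e \<and>
      {g \<in> extensional \<Omega>. \<forall>z\<in>K. dist (g z) (f z) < e} \<subseteq> \<Union>\<K>"
  proof
    fix f assume "f \<in> \<Union>\<K>"
    then obtain S where S: "S \<in> \<K>" "f \<in> S" by (rule UnionE)
    have "?P S" using * S(1) by (rule bspec)
    then obtain K e where "compact K" "K \<subseteq> \<Omega>" "0 < e"
        "{g \<in> extensional \<Omega>. \<forall>z\<in>K. dist (g z) (f z) < e} \<subseteq> S"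
      using S(2) by blast
    moreover have "S \<subseteq> \<Union>\<K>" using S by blast
    ultimately show "\<exists>K e. compact K \<and> K \<subseteq> \<Omega> \<and> 0 < e \<and>
        {g \<in> extensional \<Omega>. \<forall>z\<in>K. dist (g z) (f z) < e} \<subseteq> \<Union>\<K>"
      by (meson order_trans)
  qed
qed

lemma openin_locally_uniform_topology:
  "openin (locally_uniform_topology \<Omega>) U \<longleftrightarrow> U \<subseteq> extensional \<Omega> \<and>
     (\<forall>f\<in>U. \<exists>K e. compact K \<and> K \<subseteq> \<Omega> \<and> 0 < e \<and>
        {g \<in> extensional \<Omega>. \<forall>z\<in>K. dist (g z) (f z) < e} \<subseteq> U)"
  unfolding locally_uniform_topology_def
  by (subst topology_inverse'[OF istopology_locally_uniform]) (rule refl)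

lemma topspace_locally_uniform_topology [simp]:
  "topspace (locally_uniform_topology \<Omega>) = extensional \<Omega>"
proof
  show "topspace (locally_uniform_topology \<Omega>) \<subseteq> extensional \<Omega>"
    using openin_locally_uniform_topology openin_topspace by blast
  have "openin (locally_uniform_topology \<Omega>) (extensional \<Omega>)"
    unfolding openin_locally_uniform_topology
    by (auto intro!: exI[of _ "{}"] exI[of _ "1::real"])
  then show "extensional \<Omega> \<subseteq> topspace (locally_uniform_topology \<Omega>)"
    by (rule openin_subset)
qed

lemma topspace_bounded_loc_univalent_topology [simp]:
  "topspace (bounded_loc_univalent_topology \<Omega>) = bounded_loc_univalent \<Omega>"
  by (auto simp: bounded_loc_univalent_topology_def bounded_loc_univalent_def)

lemma limitin_locally_uniform_topology:
  "limitin (locally_uniform_topology \<Omega>) h f F \<longleftrightarrow> f \<in> extensional \<Omega> \<and>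
     (\<forall>\<^sub>F n in F. h n \<in> extensional \<Omega>) \<and>
     (\<forall>K. compact K \<and> K \<subseteq> \<Omega> \<longrightarrow> uniform_limit K h f F)" (is "?L \<longleftrightarrow> ?R")
proof
  assume L: ?L
  have ext: "\<forall>\<^sub>F n in F. h n \<in> extensional \<Omega>"
    using L openin_topspace[of "locally_uniform_topology \<Omega>"]
    unfolding limitin_def by auto
  have "uniform_limit K h f F" if K: "compact K" "K \<subseteq> \<Omega>" for K
    unfolding uniform_limit_iff
  proof (intro allI impI)
    fix e :: real assume e: "0 < e"
    define U where "U = {g \<in> extensional \<Omega>. \<exists>d<e. \<forall>z\<in>K. dist (g z) (f z) \<le> d}"
    have "openin (locally_uniform_topology \<Omega>) U"
      unfolding openin_locally_uniform_topology
    proof (intro conjI ballI)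
      fix g assume "g \<in> U"
      then obtain d where d: "d < e" "\<forall>z\<in>K. dist (g z) (f z) \<le> d" by (auto simp: U_def)
      have "{k \<in> extensional \<Omega>. \<forall>z\<in>K. dist (k z) (g z) < (e - d) / 2} \<subseteq> U"
      proof
        fix k assume k: "k \<in> {k \<in> extensional \<Omega>. \<forall>z\<in>K. dist (k z) (g z) < (e - d) / 2}"
        have "dist (k z) (f z) \<le> (e + d) / 2" if z: "z \<in> K" for z
        proof -
          have "dist (k z) (f z) \<le> dist (k z) (g z) + dist (g z) (f z)"
            by (rule dist_triangle)
          also have "\<dots> \<le> (e - d) / 2 + d"
            using k d z by (intro add_mono) (auto intro: less_imp_le)
          also have "\<dots> = (e + d) / 2" by (simp add: field_simps)
          finally show ?thesis .
        qed
        then show "k \<in> U" using k d by (auto simp: U_def intro!: exI[of _ "(e + d) / 2"])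
      qed
      then show "\<exists>K e. compact K \<and> K \<subseteq> \<Omega> \<and> 0 < e \<and>
          {k \<in> extensional \<Omega>. \<forall>z\<in>K. dist (k z) (g z) < e} \<subseteq> U"
        using K d by (intro exI[of _ K] exI[of _ "(e - d) / 2"]) auto
    qed (auto simp: U_def)
    moreover have "f \<in> U" using L e by (auto simp: U_def limitin_def)
    ultimately have "\<forall>\<^sub>F n in F. h n \<in> U" using L unfolding limitin_def by blast
    then show "\<forall>\<^sub>F n in F. \<forall>z\<in>K. dist (h n z) (f z) < e"
      by eventually_elim (auto simp: U_def)
  qed
  then show ?R using ext L by (auto simp: limitin_def)
next
  assume R: ?R
  show ?L
    unfolding limitin_def topspace_locally_uniform_topology
  proof (intro conjI allI impI)
    show "f \<in> extensional \<Omega>" using R by blast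
    fix U assume U: "openin (locally_uniform_topology \<Omega>) U \<and> f \<in> U"
    then obtain K e where K: "compact K" "K \<subseteq> \<Omega>" "0 < e"
        "{g \<in> extensional \<Omega>. \<forall>z\<in>K. dist (g z) (f z) < e} \<subseteq> U"
      unfolding openin_locally_uniform_topology by blast
    have "\<forall>\<^sub>F n in F. \<forall>z\<in>K. dist (h n z) (f z) < e"
      using R K unfolding uniform_limit_iff by blast
    moreover have "\<forall>\<^sub>F n in F. h n \<in> extensional \<Omega>" using R by blast
    ultimately show "\<forall>\<^sub>F n in F. h n \<in> U"
      by eventually_elim (use K(4) in auto)
  qed
qed

lemma limitin_locally_uniform_topology_iff:
  assumes "open \<Omega>"
  shows "limitin (locally_uniform_topology \<Omega>) h f F \<longleftrightarrow> f \<in> extensional \<Omega> \<and>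
     (\<forall>\<^sub>F n in F. h n \<in> extensional \<Omega>) \<and>
     (\<forall>z\<in>\<Omega>. \<exists>r>0. ball z r \<subseteq> \<Omega> \<and> uniform_limit (ball z r) h f F)"
proof -
  have "(\<forall>K. compact K \<and> K \<subseteq> \<Omega> \<longrightarrow> uniform_limit K h f F) \<longleftrightarrow>
      (\<forall>z\<in>\<Omega>. \<exists>r>0. ball z r \<subseteq> \<Omega> \<and> uniform_limit (ball z r) h f F)" (is "?A \<longleftrightarrow> ?B")
  proof
    assume A: ?A
    show ?B
    proof
      fix z assume "z \<in> \<Omega>"
      then obtain r where r: "r > 0" "cball z r \<subseteq> \<Omega>"
        using assms open_contains_cball by blast
      then have "uniform_limit (cball z r) h f F" using A by auto
      then have "uniform_limit (ball z r) h f F"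
        by (rule uniform_limit_on_subset) auto
      moreover have "ball z r \<subseteq> \<Omega>" using r ball_subset_cball by blast
      ultimately show "\<exists>r>0. ball z r \<subseteq> \<Omega> \<and> uniform_limit (ball z r) h f F"
        using r by blast
    qed
  next
    assume B: ?B
    then obtain r where r: "\<And>z. z \<in> \<Omega> \<Longrightarrow> r z > 0"
        "\<And>z. z \<in> \<Omega> \<Longrightarrow> uniform_limit (ball z (r z)) h f F" by metis
    show ?A
    proof (intro allI impI)
      fix K assume K: "compact K \<and> K \<subseteq> \<Omega>"
      have "K \<subseteq> (\<Union>z\<in>K. ball z (r z))" using K r by force
      then obtain C where C: "C \<subseteq> K" "finite C" "K \<subseteq> (\<Union>z\<in>C. ball z (r z))"
        using K by (elim compactE_image[of K K "\<lambda>z. ball z (r z)", rotated 2]) auto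
      show "uniform_limit K h f F"
        unfolding uniform_limit_iff
      proof (intro allI impI)
        fix e :: real assume "0 < e"
        then have "\<forall>\<^sub>F n in F. \<forall>z\<in>C. \<forall>w\<in>ball z (r z). dist (h n w) (f w) < e"
          using C K r unfolding uniform_limit_iff
          by (intro eventually_ball_finite) auto
        then show "\<forall>\<^sub>F n in F. \<forall>w\<in>K. dist (h n w) (f w) < e"
          by eventually_elim (use C(3) in blast)
      qed
    qed
  qed
  then show ?thesis by (simp add: limitin_locally_uniform_topology)
qed

end

theory Submission
  imports Defs
begin

text \<open>
  The Riemann map turns the problem into one on the unit disc, where the automorphisms
  \<open>z \<mapsto> disc_dil T z\<close> push any compact set towards a boundary point. In the coordinate
  \<open>\<zeta> = (1 + z) / (1 - z)\<close>, which maps the disc to the right half-plane, they are the dilations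
  \<open>\<zeta> \<mapsto> \<zeta> / T\<close>.

  The heart of the matter is that two locally univalent functions \<open>h\<close> and \<open>g\<close>, both bounded by a
  constant below \<open>1\<close> on the closed disc, can be fused into a single one, \<open>f\<close>, that is close to \<open>h\<close>
  on a large compact set and close to \<open>g \<circ> disc_dil T\<close> on the part of the disc that
  \<open>disc_dil T\<close> brings back to that compact set. Approximation theorems of Runge type do not help,
  because the bound \<open>1\<close> has to hold on the whole disc. Suppose first that \<open>h 1 = g (-1) = c\<close>, and
  write \<open>h' = exp p\<close>, \<open>g' = exp q\<close>, \<open>\<mu> = disc_dil (t\<^sup>2)\<close>. The sum \<open>h + g \<circ> \<mu> - c\<close> has all the
  required approximation properties and nearly the right bound, since at every point of the disc
  one of \<open>h\<close> and \<open>g \<circ> \<mu>\<close> is close to \<open>c\<close>. Its derivative may vanish, however. This is repaired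
  by taking \<open>f' = exp (p (1 - s) + (q \<circ> \<mu>) s) (1 + \<mu>')\<close>, where \<open>s = \<zeta> / (\<zeta> + t)\<close> is a
  rational cutoff. The first factor is an exponential, and \<open>1 + \<mu>'\<close> has no zero because \<open>\<mu>'\<close> is
  a positive multiple of the square of a number in the right half-plane. The cutoff \<open>s\<close> is small
  where \<open>h'\<close> carries its mass and close to \<open>1\<close> where \<open>(g \<circ> \<mu>)'\<close> does, so that integration
  along the rays of the half-plane shows that \<open>f\<close> differs from \<open>h + g \<circ> \<mu> - c\<close> by
  \<open>O(1 / sqrt t)\<close> uniformly on the disc (lemmas \<open>norm_bound_of_cutoff_deriv_bound\<close>,
  \<open>gluing_rate\<close> and \<open>gluing\<close>).

  When \<open>h 1 \<noteq> g (-1)\<close>, a third function is placed between the two, which maps the disc to a thin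
  neighbourhood of the segment from \<open>h 1\<close> to \<open>g (-1)\<close> (lemma \<open>connector_exists\<close>). Gluing twice
  then treats arbitrary pairs (lemma \<open>approximate_two_functions\<close>).

  The rest is the usual construction of a universal function. Montel's theorem supplies a dense
  sequence. One runs through it, visiting each member infinitely often, and changes the current
  function on a growing compact set by at most \<open>2\<^sup>-\<^sup>n\<close> so that some automorphism makes it
  approximate the next member of the sequence. The limit is locally univalent by Hurwitz's theorem,
  as it cannot be constant (lemma \<open>disc_universal_function\<close>).
\<close>

section \<open>Dilations of the half-plane, seen in the disc\<close>

definition dil_den :: "real \<Rightarrow> complex \<Rightarrow> complex" where
  "dil_den T z = (1 + z) + of_real T * (1 - z)"

text \<open>
  In the half-plane coordinate \<open>\<zeta> = (1 + z) / (1 - z)\<close> the next two functions are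
  \<open>\<zeta> / (\<zeta> + t)\<close> and the dilation \<open>\<zeta> \<mapsto> \<zeta> / T\<close>. Clearing the denominator \<open>1 - z\<close> makes the
  formulas valid at the boundary point \<open>z = 1\<close> as well, and holomorphic beyond the closed disc.
\<close>

definition cutoff :: "real \<Rightarrow> complex \<Rightarrow> complex" where
  "cutoff t z = (1 + z) / dil_den t z"

definition disc_dil :: "real \<Rightarrow> complex \<Rightarrow> complex" where
  "disc_dil T z = ((1 + z) - of_real T * (1 - z)) / dil_den T z"

lemma Re_one_plus_times_cnj_one_minus:
  "Re ((1 + z) * cnj (1 - z)) = 1 - (norm z)\<^sup>2"
  by (cases z) (simp add: cmod_def power2_eq_square algebra_simps)

text \<open>
  Two complex numbers at an angle of at most a right angle: their sum is at least as long as the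
  hypotenuse. This is the only geometric input of the estimates below; it applies to \<open>1 + z\<close> and
  \<open>T (1 - z)\<close> for \<open>z\<close> in the closed disc, and to \<open>\<zeta>\<close> and a positive real for \<open>\<zeta>\<close> in the
  half-plane.
\<close>

lemma norm_add_ge_of_Re_nonneg:
  fixes a b :: complex
  assumes "Re (a * cnj b) \<ge> 0"
  shows "(norm (a + b))\<^sup>2 \<ge> (norm a)\<^sup>2 + (norm b)\<^sup>2"
  using assms unfolding cmod_power2 by (simp add: power2_eq_square algebra_simps)

lemma norm_dil_den_ge:
  assumes "t > 0" "norm z \<le> 1"
  shows "(norm (dil_den t z))\<^sup>2 \<ge> (norm (1 + z))\<^sup>2 + (t * norm (1 - z))\<^sup>2"
proof -
  have "(norm z)\<^sup>2 \<le> 1" using assms(2) by (simp add: power_le_one)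
  then have "Re ((1 + z) * cnj (1 - z)) \<ge> 0"
    by (simp only: Re_one_plus_times_cnj_one_minus)
  then have "t * Re ((1 + z) * cnj (1 - z)) \<ge> 0" using assms(1) by simp
  then have "Re ((1 + z) * cnj (of_real t * (1 - z))) \<ge> 0"
    by (simp add: algebra_simps)
  from norm_add_ge_of_Re_nonneg[OF this] show ?thesis
    using assms(1) by (simp add: dil_den_def norm_mult power_mult_distrib)
qed

lemma norm_dil_den_ge':
  assumes "t > 0" "norm z \<le> 1"
  shows "norm (dil_den t z) \<ge> norm (1 + z)" "norm (dil_den t z) \<ge> t * norm (1 - z)"
proof -
  have "(norm (dil_den t z))\<^sup>2 \<ge> (norm (1 + z))\<^sup>2"
    using norm_dil_den_ge[OF assms] zero_le_power2[of "t * norm (1 - z)"] by linarith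
  then show "norm (dil_den t z) \<ge> norm (1 + z)" by (rule power2_le_imp_le) simp
  have "(norm (dil_den t z))\<^sup>2 \<ge> (t * norm (1 - z))\<^sup>2"
    using norm_dil_den_ge[OF assms] zero_le_power2[of "norm (1 + z)"] by linarith
  then show "norm (dil_den t z) \<ge> t * norm (1 - z)" by (rule power2_le_imp_le) simp
qed

lemma Re_dil_den_pos:
  assumes "T > 0" "norm z \<le> 1"
  shows "Re (dil_den T z) > 0"
proof -
  have "\<bar>Re z\<bar> \<le> 1" using abs_Re_le_cmod[of z] assms by linarith
  then have "1 + Re z > 0 \<and> T * (1 - Re z) \<ge> 0 \<or> 1 + Re z \<ge> 0 \<and> T * (1 - Re z) > 0"
    using assms(1) by (cases "Re z = -1") (auto simp: zero_le_mult_iff)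
  then show ?thesis by (auto simp: dil_den_def)
qed

lemma dil_den_nonzero: "T > 0 \<Longrightarrow> norm z \<le> 1 \<Longrightarrow> dil_den T z \<noteq> 0"
  using Re_dil_den_pos[of T z] by auto

lemma one_minus_cutoff:
  "dil_den t z \<noteq> 0 \<Longrightarrow> 1 - cutoff t z = of_real t * (1 - z) / dil_den t z"
  by (simp add: cutoff_def dil_den_def field_simps)

lemma one_plus_disc_dil:
  "dil_den T z \<noteq> 0 \<Longrightarrow> 1 + disc_dil T z = 2 * (1 + z) / dil_den T z"
  by (simp add: disc_dil_def dil_den_def field_simps)

lemma one_minus_disc_dil:
  "dil_den T z \<noteq> 0 \<Longrightarrow> 1 - disc_dil T z = 2 * of_real T * (1 - z) / dil_den T z"
  by (simp add: disc_dil_def dil_den_def field_simps)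

lemma norm_cutoff_le:
  assumes "t > 0" "norm z \<le> 1"
  shows "norm (cutoff t z) \<le> 1" "norm (1 - cutoff t z) \<le> 1"
proof -
  show "norm (cutoff t z) \<le> 1"
    using norm_dil_den_ge'[OF assms] dil_den_nonzero[OF assms]
    by (simp add: norm_divide divide_le_eq cutoff_def)
  show "norm (1 - cutoff t z) \<le> 1"
    using norm_dil_den_ge'[OF assms] dil_den_nonzero[OF assms] assms(1)
    by (simp add: one_minus_cutoff norm_divide norm_mult divide_le_eq)
qed

text \<open>
  The invariance of the hyperbolic density in an algebraic form, from which the disc and
  its closure are seen to be mapped into themselves.
\<close>

lemma norm_disc_dil_eq:
  assumes "T > 0" "norm z \<le> 1"
  shows "(norm (dil_den T z))\<^sup>2 * (1 - (norm (disc_dil T z))\<^sup>2) = 4 * T * (1 - (norm z)\<^sup>2)"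
proof -
  define d where "d = dil_den T z"
  have d: "d \<noteq> 0" using dil_den_nonzero[OF assms] by (simp add: d_def)
  have "d * disc_dil T z = (1 + z) - of_real T * (1 - z)"
    using d by (simp add: disc_dil_def d_def)
  then have "(norm d)\<^sup>2 * (norm (disc_dil T z))\<^sup>2 = (norm ((1 + z) - of_real T * (1 - z)))\<^sup>2"
    by (metis norm_mult power_mult_distrib)
  moreover have "(norm d)\<^sup>2 - (norm ((1 + z) - of_real T * (1 - z)))\<^sup>2 = 4 * T * (1 - (norm z)\<^sup>2)"
    unfolding cmod_power2 by (simp add: d_def dil_den_def power2_eq_square algebra_simps)
  ultimately show ?thesis by (simp add: d_def algebra_simps)
qed

lemma norm_disc_dil_less:
  assumes "T > 0" "norm z < 1"
  shows "norm (disc_dil T z) < 1"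
proof -
  have "(norm z)\<^sup>2 < 1" using assms(2) by (simp add: power_less_one_iff abs_square_less_1)
  then have "0 < 4 * T * (1 - (norm z)\<^sup>2)" using assms(1) by simp
  then have "0 < (norm (dil_den T z))\<^sup>2 * (1 - (norm (disc_dil T z))\<^sup>2)"
    using norm_disc_dil_eq[of T z] assms by simp
  then have "(norm (disc_dil T z))\<^sup>2 < 1"
    by (simp add: zero_less_mult_iff)
  then show ?thesis by (simp add: abs_square_less_1)
qed

lemma norm_disc_dil_le:
  assumes "T > 0" "norm z \<le> 1"
  shows "norm (disc_dil T z) \<le> 1"
proof -
  have "(norm z)\<^sup>2 \<le> 1" using assms(2) by (simp add: power_le_one)
  then have "0 \<le> 4 * T * (1 - (norm z)\<^sup>2)" using assms(1) by simp
  then have "0 \<le> (norm (dil_den T z))\<^sup>2 * (1 - (norm (disc_dil T z))\<^sup>2)"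
    using norm_disc_dil_eq[of T z] assms by simp
  then have "(norm (disc_dil T z))\<^sup>2 \<le> 1"
    using dil_den_nonzero[OF assms] by (simp add: zero_le_mult_iff)
  then show ?thesis by (simp add: abs_square_le_1)
qed

lemma disc_dil_inverse:
  assumes "T > 0" "norm z \<le> 1"
  shows "disc_dil (1 / T) (disc_dil T z) = z"
proof -
  define d where "d = dil_den T z"
  define w where "w = disc_dil T z"
  have d: "d \<noteq> 0" using dil_den_nonzero[OF assms] by (simp add: d_def)
  have w1: "1 + w = 2 * (1 + z) / d" and w2: "1 - w = 2 * of_real T * (1 - z) / d"
    using d one_plus_disc_dil one_minus_disc_dil by (auto simp: d_def w_def)
  have T: "of_real T \<noteq> (0::complex)" using assms(1) by simp
  have den: "dil_den (1 / T) w = 4 / d"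
    unfolding dil_den_def w1 w2 using T d by (simp add: field_simps)
  have "disc_dil (1 / T) w = z"
    unfolding disc_dil_def den unfolding w1 w2 using T d by (simp add: field_simps)
  then show ?thesis by (simp add: w_def)
qed

lemma has_field_derivative_disc_dil:
  assumes "dil_den T z \<noteq> 0"
  shows "(disc_dil T has_field_derivative 4 * of_real T / (dil_den T z)\<^sup>2) (at z)"
proof -
  have "((\<lambda>z. ((1 + z) - of_real T * (1 - z)) / ((1 + z) + of_real T * (1 - z)))
      has_field_derivative 4 * of_real T / (dil_den T z)\<^sup>2) (at z)"
    using assms unfolding dil_den_def
    by (auto intro!: derivative_eq_intros simp: power2_eq_square) (simp add: algebra_simps)
  then show ?thesis unfolding disc_dil_def dil_den_def .
qed

section \<open>Integration along rays of the half-plane\<close>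

lemma half_square_add: "((a::real) + b)\<^sup>2 / 2 \<le> a\<^sup>2 + b\<^sup>2"
  using zero_le_power2[of "a - b"] by (simp add: power2_diff power2_sum)

lemma mult_le_add_squares: "(a::real) \<ge> 0 \<Longrightarrow> b \<ge> 0 \<Longrightarrow> a * b \<le> a\<^sup>2 + b\<^sup>2"
  using zero_le_power2[of "a - b"] mult_nonneg_nonneg[of a b] unfolding power2_diff by linarith

lemma norm_add_of_real_ge:
  fixes \<zeta> :: complex
  assumes "Re \<zeta> \<ge> 0" "x \<ge> 0"
  shows "(norm (\<zeta> + of_real x))\<^sup>2 \<ge> (norm \<zeta>)\<^sup>2 + x\<^sup>2"
  using norm_add_ge_of_Re_nonneg[of \<zeta> "of_real x"] assms by simp

text \<open>
  The derivative bound is large in some places, but its integral over each ray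
  \<open>\<zeta> = v\<^sup>2 \<omega>\<close> of the half-plane is small. With \<open>v\<close> as parameter, the two terms of the bound are
  dominated by constant multiples of \<open>1 / (1 + v\<^sup>2)\<close> and \<open>t / (t\<^sup>2 + v\<^sup>2)\<close>, divided by \<open>sqrt t\<close>.
  These have the primitives \<open>arctan v\<close> and \<open>arctan (v / t)\<close>, whence the factor \<open>pi\<close>. The quotient
  \<open>4 t\<^sup>2 / (dil_den (t\<^sup>2) z)\<^sup>2\<close> is the derivative of \<open>disc_dil (t\<^sup>2)\<close>.
\<close>

lemma norm_bound_of_cutoff_deriv_bound:
  assumes R: "R > 1" and F: "F holomorphic_on ball 0 R" and F0: "F (-1) = 0"
    and t: "t > 1" and B: "B \<ge> 0"
    and bound: "\<And>z. norm z \<le> 1 \<Longrightarrow> norm (deriv F z) \<le>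
       B * (norm (cutoff t z) + norm (1 - cutoff t z) * norm (4 * of_real (t\<^sup>2) / (dil_den (t\<^sup>2) z)\<^sup>2))"
    and z: "norm z < 1"
  shows "norm (F z) \<le> 8 * pi * B / sqrt t"
proof (cases "z = -1")
  case False
  define \<zeta> where "\<zeta> = (1 + z) / (1 - z)"
  have z1: "1 - z \<noteq> 0" "1 + z \<noteq> 0" using z False by (auto simp: add_eq_0_iff)
  have \<zeta>0: "\<zeta> \<noteq> 0" using z1 by (simp add: \<zeta>_def)
  have "(norm z)\<^sup>2 \<le> 1" using z by (simp add: power_le_one)
  moreover have "Re \<zeta> = Re ((1 + z) * cnj (1 - z)) / (norm (1 - z))\<^sup>2"
    by (simp add: \<zeta>_def complex_div_cnj[of "1 + z" "1 - z"] power2_eq_square[symmetric] del: of_real_power)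
  ultimately have Re\<zeta>: "Re \<zeta> \<ge> 0"
    by (simp only: Re_one_plus_times_cnj_one_minus) (simp add: divide_nonneg_nonneg)
  \<comment> \<open>The square in the parametrisation keeps the majorants bounded near the start of the ray: the cutoff is at most \<open>sqrt (|\<zeta>| / t)\<close>.\<close>
  define \<omega> where "\<omega> = \<zeta> / of_real (norm \<zeta>)"
  define V where "V = sqrt (norm \<zeta>)"
  have n\<omega>: "norm \<omega> = 1" using \<zeta>0 by (simp add: \<omega>_def norm_divide)
  have Re\<omega>: "Re \<omega> \<ge> 0" using Re\<zeta> by (simp add: \<omega>_def)
  have V: "V > 0" using \<zeta>0 by (simp add: V_def)
  have V\<omega>: "of_real (V\<^sup>2) * \<omega> = \<zeta>" using \<zeta>0 by (simp add: V_def \<omega>_def)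
  define Z where "Z = (\<lambda>v::real. of_real (v\<^sup>2) * \<omega>)"
  define P where "P = (\<lambda>v. (Z v - 1) / (Z v + 1))"
  have ReZ: "Re (Z v) \<ge> 0" for v using Re\<omega> by (simp add: Z_def)
  have nZ: "norm (Z v) = v\<^sup>2" for v by (simp add: Z_def norm_mult n\<omega> norm_power)
  have Zx: "Z v + of_real x \<noteq> 0" if "x > 0" for v x
  proof -
    have "Re (Z v + of_real x) > 0" using ReZ[of v] that by simp
    then show ?thesis by (metis less_irrefl zero_complex.simps(1))
  qed
  have Z1: "Z v + 1 \<noteq> 0" for v using Zx[of 1 v] by simp
  have P1: "1 + P v = 2 * Z v / (Z v + 1)" and P2: "1 - P v = 2 / (Z v + 1)" for v
    using Z1[of v] by (auto simp: P_def field_simps)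
  have denP: "dil_den x (P v) = 2 * (Z v + of_real x) / (Z v + 1)" for x v
    unfolding dil_den_def P1 P2 by (simp add: add_divide_distrib ring_distribs)
  have nP: "norm (P v) \<le> 1" for v
  proof -
    have "(norm (Z v - 1))\<^sup>2 \<le> (norm (Z v + 1))\<^sup>2"
      using ReZ[of v] unfolding cmod_power2 by (simp add: power2_eq_square algebra_simps)
    then have "norm (Z v - 1) \<le> norm (Z v + 1)" by (rule power2_le_imp_le) simp
    then show ?thesis using Z1[of v] by (simp add: P_def norm_divide)
  qed
  have cutP: "cutoff t (P v) = Z v / (Z v + of_real t)"
    and cutP': "1 - cutoff t (P v) = of_real t / (Z v + of_real t)" for v
  proof -
    show 1: "cutoff t (P v) = Z v / (Z v + of_real t)"
      unfolding cutoff_def denP unfolding P1 using Z1[of v] by (simp del: distrib_left_numeral)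
    show "1 - cutoff t (P v) = of_real t / (Z v + of_real t)"
      unfolding 1 using Zx[of t v] t by (simp add: field_simps)
  qed
  define P' where "P' = (\<lambda>v::real. of_real (4 * v) * \<omega> / (Z v + 1)\<^sup>2)"
  have dP: "(P has_vector_derivative P' v) (at v)" for v
  proof -
    have dZ: "(Z has_vector_derivative of_real (2 * v) * \<omega>) (at v)"
      unfolding Z_def
      by (auto intro!: derivative_eq_intros simp: has_vector_derivative_def has_real_derivative_iff_has_vector_derivative algebra_simps scaleR_conv_of_real)
    have "((\<lambda>w. (w - 1) / (w + 1)) has_field_derivative 2 / (Z v + 1)\<^sup>2) (at (Z v))"
      using Z1[of v] by (auto intro!: derivative_eq_intros simp: power2_eq_square field_simps)
    from field_vector_diff_chain_at[OF dZ this] show ?thesis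
      by (simp add: o_def P_def P'_def algebra_simps)
  qed
  define \<phi> where "\<phi> = (\<lambda>v. 8 * B / sqrt t * (arctan v + arctan (v / t)))"
  have d\<phi>: "(\<phi> has_vector_derivative 8 * B / sqrt t * (1 / (1 + v\<^sup>2) + t / (t\<^sup>2 + v\<^sup>2))) (at v)" for v
  proof -
    have "t\<^sup>2 + v\<^sup>2 > 0" using t by (simp add: add_pos_nonneg)
    then have a1: "inverse (1 + (v / t)\<^sup>2) * (1 / t) = t / (t\<^sup>2 + v\<^sup>2)"
      using t by (simp add: field_simps power2_eq_square)
    have a2: "((\<lambda>v. arctan (v / t)) has_real_derivative inverse (1 + (v / t)\<^sup>2) * (1 / t)) (at v)"
      using t by (auto intro!: derivative_eq_intros)
    have "((\<lambda>v. arctan (v / t)) has_real_derivative t / (t\<^sup>2 + v\<^sup>2)) (at v)"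
      by (rule DERIV_cong[OF a2 a1])
    moreover have "(arctan has_real_derivative 1 / (1 + v\<^sup>2)) (at v)"
      by (auto intro!: derivative_eq_intros simp: inverse_eq_divide)
    ultimately have "(\<phi> has_real_derivative 8 * B / sqrt t * (1 / (1 + v\<^sup>2) + t / (t\<^sup>2 + v\<^sup>2))) (at v)"
      unfolding \<phi>_def by (intro DERIV_cmult DERIV_add)
    then show ?thesis by (simp add: has_real_derivative_iff_has_vector_derivative)
  qed
  have cb: "P v \<in> ball 0 R" for v using nP[of v] R by simp
  have dF: "((F \<circ> P) has_vector_derivative P' v * deriv F (P v)) (at v)" for v
    by (rule field_vector_diff_chain_at[OF dP holomorphic_derivI[OF F open_ball cb]])
  have main: "norm (P' v * deriv F (P v)) \<le> 8 * B / sqrt t * (1 / (1 + v\<^sup>2) + t / (t\<^sup>2 + v\<^sup>2))"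
    if v: "v > 0" for v
  proof -
    \<comment> \<open>The mean inequality \<open>|\<zeta>|\<^sup>2 + t\<^sup>2 \<ge> |\<zeta>| t\<close>, which trades half of the decay of the cutoff for integrability.\<close>
    have nt: "norm (Z v + of_real t) \<ge> v * sqrt t"
    proof -
      have "(v * sqrt t)\<^sup>2 \<le> (v\<^sup>2)\<^sup>2 + t\<^sup>2"
        using t mult_le_add_squares[of "v\<^sup>2" t] by (simp add: power_mult_distrib)
      also have "\<dots> \<le> (norm (Z v + of_real t))\<^sup>2"
        using norm_add_of_real_ge[OF ReZ[of v], of t] t nZ[of v] by simp
      finally show ?thesis by (rule power2_le_imp_le) simp
    qed
    have n1: "(norm (Z v + 1))\<^sup>2 \<ge> (1 + v\<^sup>2)\<^sup>2 / 2"
    proof -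
      have "(1 + v\<^sup>2)\<^sup>2 / 2 \<le> (v\<^sup>2)\<^sup>2 + 1\<^sup>2"
        using half_square_add[of 1 "v\<^sup>2"] by linarith
      then show ?thesis using norm_add_of_real_ge[OF ReZ[of v], of 1] nZ[of v] by simp
    qed
    have n2: "(norm (Z v + of_real (t\<^sup>2)))\<^sup>2 \<ge> (t\<^sup>2 + v\<^sup>2)\<^sup>2 / 2"
    proof -
      have "(t\<^sup>2 + v\<^sup>2)\<^sup>2 / 2 \<le> (v\<^sup>2)\<^sup>2 + (t\<^sup>2)\<^sup>2"
        using half_square_add[of "t\<^sup>2" "v\<^sup>2"] by linarith
      then show ?thesis using norm_add_of_real_ge[OF ReZ[of v], of "t\<^sup>2"] nZ[of v] by simp
    qed
    have v2: "1 + v\<^sup>2 > 0" "t\<^sup>2 + v\<^sup>2 > 0" using t by (auto simp: add_pos_nonneg)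
    have st: "sqrt t > 0" using t by simp
    have nP': "norm (P' v) \<le> 8 * v / (1 + v\<^sup>2)\<^sup>2"
    proof -
      have "norm (P' v) = 4 * v / (norm (Z v + 1))\<^sup>2"
        using v by (simp add: P'_def norm_divide norm_mult norm_power n\<omega>)
      also have "\<dots> \<le> 4 * v / ((1 + v\<^sup>2)\<^sup>2 / 2)"
        using n1 v v2 by (intro divide_left_mono) (auto intro!: mult_pos_pos simp: Z1)
      finally show ?thesis by simp
    qed
    have a: "norm (cutoff t (P v)) \<le> v / sqrt t"
    proof -
      have "norm (cutoff t (P v)) = v\<^sup>2 / norm (Z v + of_real t)"
        by (simp add: cutP norm_divide nZ)
      also have "\<dots> \<le> v\<^sup>2 / (v * sqrt t)"
        using nt v st Zx[of t v] t by (intro divide_left_mono) (auto intro!: mult_pos_pos)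
      finally show ?thesis using v by (simp add: power2_eq_square)
    qed
    have b: "norm (1 - cutoff t (P v)) \<le> sqrt t / v"
    proof -
      have "norm (1 - cutoff t (P v)) = t / norm (Z v + of_real t)"
        using t by (simp add: cutP' norm_divide)
      also have "\<dots> \<le> t / (v * sqrt t)"
        using nt v st Zx[of t v] t by (intro divide_left_mono) (auto intro!: mult_pos_pos)
      also have "\<dots> = (t / sqrt t) / v" by simp
      also have "\<dots> = sqrt t / v" using t by (simp only: real_div_sqrt)
      finally show ?thesis .
    qed
    have c: "norm (4 * of_real (t\<^sup>2) / (dil_den (t\<^sup>2) (P v))\<^sup>2) * norm (P' v) \<le> 8 * v * t\<^sup>2 / (t\<^sup>2 + v\<^sup>2)\<^sup>2"
    proof -
      have "4 * of_real (t\<^sup>2) / (dil_den (t\<^sup>2) (P v))\<^sup>2 * P' v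
          = of_real (4 * v * t\<^sup>2) * \<omega> / (Z v + of_real (t\<^sup>2))\<^sup>2"
        using Z1[of v] Zx[of "t\<^sup>2" v] t unfolding denP P'_def
        by (simp add: power_divide power_mult_distrib del: distrib_left_numeral)
      then have "norm (4 * of_real (t\<^sup>2) / (dil_den (t\<^sup>2) (P v))\<^sup>2) * norm (P' v)
          = 4 * v * t\<^sup>2 / (norm (Z v + of_real (t\<^sup>2)))\<^sup>2"
        using v by (simp only: norm_mult[symmetric]) (simp add: norm_divide norm_mult norm_power n\<omega>)
      also have "\<dots> \<le> 4 * v * t\<^sup>2 / ((t\<^sup>2 + v\<^sup>2)\<^sup>2 / 2)"
        using n2 v v2 t Zx[of "t\<^sup>2" v] by (intro divide_left_mono) (auto intro!: mult_pos_pos)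
      finally show ?thesis by simp
    qed
    have A: "norm (cutoff t (P v)) * norm (P' v) \<le> 8 / sqrt t * (1 / (1 + v\<^sup>2))"
    proof -
      have "norm (cutoff t (P v)) * norm (P' v) \<le> v / sqrt t * (8 * v / (1 + v\<^sup>2)\<^sup>2)"
        using a nP' v st by (intro mult_mono) auto
      also have "\<dots> = 8 / sqrt t * (v\<^sup>2 / (1 + v\<^sup>2)\<^sup>2)" by (simp add: power2_eq_square)
      also have "\<dots> \<le> 8 / sqrt t * ((1 + v\<^sup>2) / (1 + v\<^sup>2)\<^sup>2)"
        using st by (intro mult_left_mono divide_right_mono) auto
      also have "(1 + v\<^sup>2) / (1 + v\<^sup>2)\<^sup>2 = 1 / (1 + v\<^sup>2)"
        using v2 by (simp add: power2_eq_square)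
      finally show ?thesis .
    qed
    have C: "norm (1 - cutoff t (P v)) * (norm (4 * of_real (t\<^sup>2) / (dil_den (t\<^sup>2) (P v))\<^sup>2) * norm (P' v))
        \<le> 8 / sqrt t * (t / (t\<^sup>2 + v\<^sup>2))"
    proof -
      have "norm (1 - cutoff t (P v)) * (norm (4 * of_real (t\<^sup>2) / (dil_den (t\<^sup>2) (P v))\<^sup>2) * norm (P' v))
          \<le> sqrt t / v * (8 * v * t\<^sup>2 / (t\<^sup>2 + v\<^sup>2)\<^sup>2)"
        using b c v st by (intro mult_mono) auto
      also have "\<dots> = 8 * sqrt t * (t\<^sup>2 / (t\<^sup>2 + v\<^sup>2)\<^sup>2)" using v by simp
      also have "\<dots> \<le> 8 * sqrt t * ((t\<^sup>2 + v\<^sup>2) / (t\<^sup>2 + v\<^sup>2)\<^sup>2)"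
        using st by (intro mult_left_mono divide_right_mono) auto
      also have "(t\<^sup>2 + v\<^sup>2) / (t\<^sup>2 + v\<^sup>2)\<^sup>2 = 1 / (t\<^sup>2 + v\<^sup>2)"
        using v2 by (simp add: power2_eq_square)
      also have "8 * sqrt t * (1 / (t\<^sup>2 + v\<^sup>2)) = 8 * (t / sqrt t) * (1 / (t\<^sup>2 + v\<^sup>2))"
        using t by (simp only: real_div_sqrt)
      also have "\<dots> = 8 / sqrt t * (t / (t\<^sup>2 + v\<^sup>2))" by simp
      finally show ?thesis .
    qed
    have alg: "B * (8 / s * x + 8 / s * y) = 8 * B / s * (x + y)" for s x y :: real
      by (simp add: algebra_simps add_divide_distrib)
    have "norm (P' v * deriv F (P v)) = norm (P' v) * norm (deriv F (P v))" by (simp add: norm_mult)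
    also have "\<dots> \<le> norm (P' v) * (B * (norm (cutoff t (P v)) + norm (1 - cutoff t (P v)) * norm (4 * of_real (t\<^sup>2) / (dil_den (t\<^sup>2) (P v))\<^sup>2)))"
      by (intro mult_left_mono bound nP) simp
    also have "\<dots> = B * (norm (cutoff t (P v)) * norm (P' v) + norm (1 - cutoff t (P v)) * (norm (4 * of_real (t\<^sup>2) / (dil_den (t\<^sup>2) (P v))\<^sup>2) * norm (P' v)))"
      by (simp only: algebra_simps)
    also have "\<dots> \<le> B * (8 / sqrt t * (1 / (1 + v\<^sup>2)) + 8 / sqrt t * (t / (t\<^sup>2 + v\<^sup>2)))"
      using A C B by (intro mult_left_mono add_mono)
    also have "\<dots> = 8 * B / sqrt t * (1 / (1 + v\<^sup>2) + t / (t\<^sup>2 + v\<^sup>2))"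
      by (rule alg)
    finally show ?thesis .
  qed
  have "norm ((F \<circ> P) V - (F \<circ> P) 0) \<le> \<phi> V - \<phi> 0"
  proof (rule differentiable_bound_general)
    show "0 < V" by (rule V)
    show "continuous_on {0..V} (F \<circ> P)"
      using dF by (meson continuous_at_imp_continuous_on has_vector_derivative_continuous)
    show "continuous_on {0..V} \<phi>"
      using d\<phi> by (meson continuous_at_imp_continuous_on has_vector_derivative_continuous)
    show "((F \<circ> P) has_vector_derivative P' v * deriv F (P v)) (at v)" for v by (rule dF)
    show "(\<phi> has_vector_derivative 8 * B / sqrt t * (1 / (1 + v\<^sup>2) + t / (t\<^sup>2 + v\<^sup>2))) (at v)" for v
      by (rule d\<phi>)
    show "norm (P' v * deriv F (P v)) \<le> 8 * B / sqrt t * (1 / (1 + v\<^sup>2) + t / (t\<^sup>2 + v\<^sup>2))"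
      if "0 < v" "v < V" for v using that(1) by (rule main)
  qed
  moreover have "P V = z"
  proof -
    have "Z V = \<zeta>" using V\<omega> by (simp add: Z_def)
    moreover have "\<zeta> + 1 = 2 / (1 - z)" "\<zeta> - 1 = 2 * z / (1 - z)"
      using z1 by (simp_all add: \<zeta>_def field_simps)
    ultimately show ?thesis using z1 by (simp add: P_def)
  qed
  moreover have "P 0 = -1" by (simp add: P_def Z_def)
  moreover have "\<phi> V - \<phi> 0 \<le> 8 * B / sqrt t * pi"
  proof -
    have "arctan V + arctan (V / t) \<le> pi" using arctan_ubound[of V] arctan_ubound[of "V / t"] by simp
    then show ?thesis unfolding \<phi>_def using B t
      by simp (intro divide_right_mono mult_left_mono, auto)
  qed
  ultimately show ?thesis using F0 by (simp add: algebra_simps)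
qed (use z in simp)

section \<open>Gluing two locally univalent functions\<close>

text \<open>
  The functions to be glued are required to behave well up to and beyond the unit circle,
  so that values at \<open>1\<close> and \<open>-1\<close>, logarithms of the derivative and all bounds are available on the
  closed disc. Dilating the argument shows that this loses nothing, see
  \<open>strict_loc_univalent_approximates\<close>.
\<close>

definition strict_loc_univalent :: "(complex \<Rightarrow> complex) set" where
  "strict_loc_univalent = {f. \<exists>R>1. f holomorphic_on ball 0 R \<and> (\<forall>z\<in>ball 0 R. deriv f z \<noteq> 0) \<and>
     (\<forall>z\<in>cball 0 1. norm (f z) < 1)}"

lemma open_superset_cball_contains_ball:
  fixes W :: "complex set"
  assumes "open W" "cball 0 1 \<subseteq> W"
  shows "\<exists>R>1. ball 0 R \<subseteq> W"
proof -
  obtain \<epsilon> where \<epsilon>: "\<epsilon> > 0" "(\<Union>x\<in>cball 0 1. ball x \<epsilon>) \<subseteq> W"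
    using compact_subset_open_imp_ball_epsilon_subset[OF compact_cball assms] by blast
  have "ball 0 (1 + \<epsilon>) \<subseteq> W"
  proof
    fix z :: complex assume z: "z \<in> ball 0 (1 + \<epsilon>)"
    show "z \<in> W"
    proof (cases "norm z \<le> 1")
      case True
      then show ?thesis using assms(2) by auto
    next
      case False
      define w where "w = z / of_real (norm z)"
      have nz: "z \<noteq> 0" "norm z > 1" using False by auto
      have w: "norm w = 1" using nz by (simp add: w_def norm_divide)
      have "z - w = of_real (norm z - 1) * w"
        using nz by (simp add: w_def field_simps)
      then have "norm (z - w) = norm z - 1"
        using nz w by (simp only: norm_mult norm_of_real) simp
      then have "z \<in> ball w \<epsilon>" using z by (simp add: dist_norm norm_minus_commute)
      then show ?thesis using \<epsilon>(2) w by (metis UN_I dist_0_norm less_irrefl mem_cball not_le subsetD)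
    qed
  qed
  then show ?thesis using \<epsilon>(1) by (intro exI[of _ "1 + \<epsilon>"]) auto
qed

lemma strict_loc_univalentE:
  assumes "f \<in> strict_loc_univalent"
  obtains R p M \<rho> where "R > 1" "f holomorphic_on ball 0 R" "p holomorphic_on ball 0 R"
    "\<And>z. z \<in> ball 0 R \<Longrightarrow> deriv f z = exp (p z)"
    "M \<ge> 0" "\<And>z. norm z \<le> 1 \<Longrightarrow> norm (p z) \<le> M"
    "\<rho> < 1" "\<And>z. norm z \<le> 1 \<Longrightarrow> norm (f z) \<le> \<rho>"
    "\<And>z w. norm z \<le> 1 \<Longrightarrow> norm w \<le> 1 \<Longrightarrow> norm (f z - f w) \<le> exp M * norm (z - w)"
proof -
  obtain R where R: "R > 1" "f holomorphic_on ball 0 R" "\<And>z. z \<in> ball 0 R \<Longrightarrow> deriv f z \<noteq> 0"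
      and f1: "\<forall>z\<in>cball 0 1. norm (f z) < 1"
    using assms unfolding strict_loc_univalent_def by blast
  have sub: "cball 0 1 \<subseteq> ball (0::complex) R" using R(1) by auto
  have "(0::complex) \<in> ball 0 R" using R by auto
  then obtain p where p: "p holomorphic_on ball 0 R" "\<And>z. z \<in> ball 0 R \<Longrightarrow> exp (p z) = deriv f z"
    using holomorphic_logarithm_exists[of "ball 0 R" "deriv f" 0] R
    by (metis convex_ball holomorphic_deriv open_ball)
  have "compact (p ` cball 0 1)"
    using sub p(1) by (meson compact_cball compact_continuous_image continuous_on_subset holomorphic_on_imp_continuous_on)
  then obtain M where M: "M > 0" "\<And>z. norm z \<le> 1 \<Longrightarrow> norm (p z) \<le> M"
    using compact_imp_bounded bounded_pos[of "p ` cball 0 1"] by auto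
  have "continuous_on (cball 0 1) (\<lambda>z. norm (f z))"
    using R(2) sub by (intro continuous_on_norm) (meson continuous_on_subset holomorphic_on_imp_continuous_on)
  then obtain x where x: "x \<in> cball 0 1" "\<forall>y\<in>cball 0 1. norm (f y) \<le> norm (f x)"
    using continuous_attains_sup[of "cball (0::complex) 1" "\<lambda>z. norm (f z)"] by auto
  have lip: "norm (f z - f w) \<le> exp M * norm (z - w)" if "norm z \<le> 1" "norm w \<le> 1" for z w
  proof (rule field_differentiable_bound[of "cball 0 1" f "deriv f"])
    show "(f has_field_derivative deriv f z) (at z within cball 0 1)" if "z \<in> cball 0 1" for z
      using holomorphic_derivI[OF R(2) open_ball] that sub by (meson has_field_derivative_at_within subsetD)
    show "norm (deriv f z) \<le> exp M" if "z \<in> cball 0 1" for z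
    proof -
      have "norm (deriv f z) = norm (exp (p z))" using p(2) that sub by (metis subsetD)
      also have "\<dots> \<le> exp M" using M(2)[of z] that complex_Re_le_cmod[of "p z"] by simp
      finally show ?thesis .
    qed
  qed (use that in auto)
  show ?thesis
  proof (rule that[of R p M "norm (f x)"])
    show "norm (f x) < 1" using f1 x by blast
    show "norm (f z) \<le> norm (f x)" if "norm z \<le> 1" for z using x that by auto
  qed (use R p M lip in auto)
qed

lemma norm_exp_diff_le:
  fixes a b :: complex
  assumes "norm a \<le> K" "norm b \<le> K"
  shows "norm (exp a - exp b) \<le> exp K * norm (a - b)"
proof (rule field_differentiable_bound[of "cball 0 K" exp exp])
  show "(exp has_field_derivative exp z) (at z within cball 0 K)" for z :: complex
    by (rule has_field_derivative_at_within[OF DERIV_exp])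
  show "norm (exp z) \<le> exp K" if "z \<in> cball 0 K" for z :: complex
    using that complex_Re_le_cmod[of z] by simp
qed (use assms in auto)

text \<open>
  Here \<open>s\<close> will be the value of the cutoff. The convex-like combination of the exponents
  stays bounded although \<open>s\<close> is complex, as \<open>s\<close> and \<open>1 - s\<close> both lie in the closed unit disc.
\<close>

lemma interpolated_exponent_bounds:
  assumes "norm a \<le> M" "norm b \<le> M" "norm s \<le> 1" "norm (1 - s) \<le> 1"
  defines "U \<equiv> a * (1 - s) + b * (s::complex)"
  shows "norm (exp U - exp a) \<le> 2 * M * exp (2 * M) * norm s"
    and "norm (exp U - exp b) \<le> 2 * M * exp (2 * M) * norm (1 - s)"
proof -
  have M: "M \<ge> 0" using assms(1) norm_ge_zero order_trans by blast
  have "norm U \<le> norm a * norm (1 - s) + norm b * norm s"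
    unfolding U_def by (metis norm_mult norm_triangle_ineq)
  also have "\<dots> \<le> M * 1 + M * 1" using assms M by (intro add_mono mult_mono) auto
  finally have U: "norm U \<le> 2 * M" by simp
  have ab: "norm (b - a) \<le> 2 * M" using norm_triangle_ineq4[of b a] assms by linarith
  have "U - a = (b - a) * s" "U - b = (a - b) * (1 - s)" by (simp_all add: U_def algebra_simps)
  then have "norm (U - a) \<le> 2 * M * norm s" "norm (U - b) \<le> 2 * M * norm (1 - s)"
    using ab by (auto simp: norm_mult norm_minus_commute intro!: mult_right_mono)
  note Uab = this
  have "norm (exp U - exp a) \<le> exp (2 * M) * norm (U - a)"
    using U assms(1) M by (intro norm_exp_diff_le) auto
  also have "\<dots> \<le> exp (2 * M) * (2 * M * norm s)" using Uab(1) by (intro mult_left_mono) auto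
  finally show "norm (exp U - exp a) \<le> 2 * M * exp (2 * M) * norm s" by (simp only: ac_simps)
  have "norm (exp U - exp b) \<le> exp (2 * M) * norm (U - b)"
    using U assms(2) M by (intro norm_exp_diff_le) auto
  also have "\<dots> \<le> exp (2 * M) * (2 * M * norm (1 - s))" using Uab(2) by (intro mult_left_mono) auto
  finally show "norm (exp U - exp b) \<le> 2 * M * exp (2 * M) * norm (1 - s)" by (simp only: ac_simps)
qed

text \<open>
  A zero would give \<open>(dil_den (t\<^sup>2) z)\<^sup>2 = - 4 t\<^sup>2\<close>, which makes \<open>dil_den (t\<^sup>2) z\<close> purely
  imaginary; but its real part is positive.
\<close>

lemma one_plus_deriv_disc_dil_nonzero:
  assumes "t > 0" "norm z \<le> 1"
  shows "1 + 4 * of_real (t\<^sup>2) / (dil_den (t\<^sup>2) z)\<^sup>2 \<noteq> 0"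
proof
  define d where "d = dil_den (t\<^sup>2) z"
  have d: "d \<noteq> 0" "Re d > 0"
    using dil_den_nonzero[of "t\<^sup>2" z] Re_dil_den_pos[of "t\<^sup>2" z] assms by (auto simp: d_def)
  assume "1 + 4 * of_real (t\<^sup>2) / (dil_den (t\<^sup>2) z)\<^sup>2 = 0"
  then have "d\<^sup>2 + 4 * of_real (t\<^sup>2) = 0" using d by (simp add: d_def[symmetric] field_simps)
  then have "(d + 2 * \<i> * of_real t) * (d - 2 * \<i> * of_real t) = 0"
    by (simp add: algebra_simps power2_eq_square)
  then have "d = - (2 * \<i> * of_real t) \<or> d = 2 * \<i> * of_real t"
    by (auto simp: add_eq_0_iff2)
  then show False using d(2) by auto
qed

text \<open>
  The fused function \<open>f\<close> differs by \<open>O(1 / sqrt t)\<close> from \<open>h + g \<circ> \<mu> - c\<close>, where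
  \<open>\<mu> = disc_dil (t\<^sup>2)\<close> and \<open>c = h 1 = g (-1)\<close>. The disc is divided by the line \<open>|\<zeta>| = t\<close>. On the
  side of \<open>-1\<close> the point \<open>\<mu> z\<close> has distance at most \<open>2 / t\<close> from \<open>-1\<close>, so that \<open>g \<circ> \<mu>\<close> is
  close to \<open>c\<close>; on the side of \<open>1\<close> the same holds for \<open>z\<close>, \<open>1\<close> and \<open>h\<close>. As one of the two
  alternatives always applies, \<open>f\<close> inherits the strict bound of \<open>h\<close> and \<open>g\<close> once \<open>t\<close> is large.
  The normalisation at \<open>-1\<close> makes repeated gluing possible.
\<close>

lemma gluing_rate:
  assumes h: "h \<in> strict_loc_univalent" and g: "g \<in> strict_loc_univalent" and hg: "h 1 = g (-1)"
  obtains C m where "m > 0"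
    "\<And>t. t > 1 \<Longrightarrow> C / sqrt t < m \<Longrightarrow>
       \<exists>f\<in>strict_loc_univalent. f (-1) = h (-1) \<and>
         (\<forall>z. norm z \<le> 1 \<longrightarrow> norm (1 + z) \<le> t * norm (1 - z) \<longrightarrow> norm (f z - h z) \<le> C / sqrt t) \<and>
         (\<forall>z. norm z \<le> 1 \<longrightarrow> norm (1 + z) \<ge> t * norm (1 - z) \<longrightarrow> norm (f z - g (disc_dil (t\<^sup>2) z)) \<le> C / sqrt t)"
proof -
  obtain Rh p Mh \<rho>h where h: "Rh > 1" "h holomorphic_on ball 0 Rh" "p holomorphic_on ball 0 Rh"
    "\<And>z. z \<in> ball 0 Rh \<Longrightarrow> deriv h z = exp (p z)"
    "Mh \<ge> 0" "\<And>z. norm z \<le> 1 \<Longrightarrow> norm (p z) \<le> Mh"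
    "\<rho>h < 1" "\<And>z. norm z \<le> 1 \<Longrightarrow> norm (h z) \<le> \<rho>h"
    "\<And>z w. norm z \<le> 1 \<Longrightarrow> norm w \<le> 1 \<Longrightarrow> norm (h z - h w) \<le> exp Mh * norm (z - w)"
    using strict_loc_univalentE[OF h] by metis
  obtain Rg q Mg \<rho>g where g: "Rg > 1" "g holomorphic_on ball 0 Rg" "q holomorphic_on ball 0 Rg"
    "\<And>z. z \<in> ball 0 Rg \<Longrightarrow> deriv g z = exp (q z)"
    "Mg \<ge> 0" "\<And>z. norm z \<le> 1 \<Longrightarrow> norm (q z) \<le> Mg"
    "\<rho>g < 1" "\<And>z. norm z \<le> 1 \<Longrightarrow> norm (g z) \<le> \<rho>g"
    "\<And>z w. norm z \<le> 1 \<Longrightarrow> norm w \<le> 1 \<Longrightarrow> norm (g z - g w) \<le> exp Mg * norm (z - w)"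
    using strict_loc_univalentE[OF g] by metis
  define M where "M = max Mh Mg"
  define \<rho> where "\<rho> = max \<rho>h \<rho>g"
  define L where "L = exp M"
  define B where "B = 2 * M * exp (2 * M)"
  define C where "C = 2 * L + 8 * pi * B"
  define c where "c = h 1"
  have M: "norm (p z) \<le> M" "norm (q z) \<le> M" if "norm z \<le> 1" for z
    using h(6)[OF that] g(6)[OF that] by (auto simp: M_def)
  have B: "B \<ge> 0" using h(5) by (simp add: B_def M_def)
  have lip: "norm (h z - h w) \<le> L * norm (z - w)" "norm (g z - g w) \<le> L * norm (z - w)"
    if "norm z \<le> 1" "norm w \<le> 1" for z w
  proof -
    have "exp Mh * norm (z - w) \<le> L * norm (z - w)" "exp Mg * norm (z - w) \<le> L * norm (z - w)"
      by (auto simp: L_def M_def intro!: mult_right_mono)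
    then show "norm (h z - h w) \<le> L * norm (z - w)" "norm (g z - g w) \<le> L * norm (z - w)"
      using h(9)[OF that] g(9)[OF that] by linarith+
  qed
  have \<rho>: "norm (h z) \<le> \<rho>" "norm (g z) \<le> \<rho>" if "norm z \<le> 1" for z
    using h(8)[OF that] g(8)[OF that] by (auto simp: \<rho>_def)
  have "\<rho> < 1" using h(7) g(7) by (simp add: \<rho>_def)
  show ?thesis
  proof (rule that[of "1 - \<rho>" C])
    show "1 - \<rho> > 0" using \<open>\<rho> < 1\<close> by simp
    fix t :: real assume t: "t > 1" and Ct: "C / sqrt t < 1 - \<rho>"
    define T where "T = t\<^sup>2"
    have T: "T > 0" using t by (simp add: T_def)
    define \<mu> where "\<mu> = disc_dil T"
    define \<mu>' where "\<mu>' = (\<lambda>z. 4 * of_real T / (dil_den T z)\<^sup>2)"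
    have d\<mu>: "(\<mu> has_field_derivative \<mu>' z) (at z)" if "dil_den T z \<noteq> 0" for z
      using has_field_derivative_disc_dil[OF that] by (simp add: \<mu>_def \<mu>'_def)
    \<comment> \<open>All ingredients are holomorphic on the open set \<open>W\<close> defined below, which contains the closed disc and hence a larger disc, on which \<open>f\<close> can be defined as a primitive.\<close>
    define S where "S = ball 0 Rh \<inter> {z. dil_den t z * dil_den T z \<noteq> 0}"
    have contden: "continuous_on A (dil_den x)" for A x
      unfolding dil_den_def by (intro continuous_intros)
    have openS: "open S" unfolding S_def
      by (intro open_Int open_ball open_Collect_neq continuous_on_mult contden continuous_on_const)
    have cont\<mu>: "continuous_on S \<mu>"
      by (rule DERIV_continuous_on[of _ _ \<mu>']) (auto intro!: has_field_derivative_at_within d\<mu> simp: S_def)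
    have holden: "dil_den x holomorphic_on A" for x A
      unfolding dil_den_def by (intro holomorphic_intros)
    have cont\<mu>': "continuous_on S (\<lambda>z. 1 + \<mu>' z)"
      unfolding \<mu>'_def by (intro continuous_intros contden) (auto simp: S_def)
    define W where "W = (S \<inter> \<mu> -` ball 0 Rg) \<inter> (S \<inter> (\<lambda>z. 1 + \<mu>' z) -` (- {0}))"
    have "open W" unfolding W_def
      using openS cont\<mu> cont\<mu>' by (intro open_Int continuous_open_preimage) auto
    moreover have "cball 0 1 \<subseteq> W"
    proof
      fix z :: complex assume z: "z \<in> cball 0 1"
      have "norm (\<mu> z) \<le> 1" using norm_disc_dil_le[OF T, of z] z by (simp add: \<mu>_def)
      moreover have "1 + \<mu>' z \<noteq> 0"
        using one_plus_deriv_disc_dil_nonzero[of t z] z t by (simp add: \<mu>'_def T_def)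
      ultimately show "z \<in> W"
        using z h(1) g(1) dil_den_nonzero[OF T, of z] dil_den_nonzero[of t z] t
        by (auto simp: W_def S_def)
    qed
    ultimately obtain R where R: "R > 1" "ball 0 R \<subseteq> W"
      using open_superset_cball_contains_ball by blast
    define D where "D = ball (0::complex) R"
    have D: "open D" "convex D" by (auto simp: D_def)
    have DW: "z \<in> ball 0 Rh" "dil_den t z \<noteq> 0" "dil_den T z \<noteq> 0" "\<mu> z \<in> ball 0 Rg" "1 + \<mu>' z \<noteq> 0"
      if "z \<in> D" for z using that R(2) unfolding D_def W_def S_def by auto
    have cD: "z \<in> D" if "norm z \<le> 1" for z using that R(1) by (simp add: D_def)
    have hol\<mu>: "\<mu> holomorphic_on D"
      using d\<mu> DW(3) D by (meson holomorphic_onI field_differentiable_at_within field_differentiable_def)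
    have hol\<mu>': "\<mu>' holomorphic_on D"
      unfolding \<mu>'_def using DW(3) by (intro holomorphic_intros holden) auto
    have \<mu>D: "\<mu> ` D \<subseteq> ball 0 Rg" using DW(4) by blast
    have holq: "(\<lambda>z. q (\<mu> z)) holomorphic_on D"
      using holomorphic_on_compose_gen[OF hol\<mu> g(3) \<mu>D] by (simp add: o_def)
    have holg: "(\<lambda>z. g (\<mu> z)) holomorphic_on D"
      using holomorphic_on_compose_gen[OF hol\<mu> g(2) \<mu>D] by (simp add: o_def)
    have holp: "p holomorphic_on D" and holh: "h holomorphic_on D"
      using h(2,3) DW(1) by (auto intro: holomorphic_on_subset)
    have holcut: "cutoff t holomorphic_on D"
      unfolding cutoff_def using DW(2) by (intro holomorphic_intros holden) auto
    define U where "U = (\<lambda>z. p z * (1 - cutoff t z) + q (\<mu> z) * cutoff t z)"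
    define k where "k = (\<lambda>z. exp (U z) * (1 + \<mu>' z))"
    have holk: "k holomorphic_on D"
      unfolding k_def U_def
      by (intro holomorphic_intros holp holq holcut hol\<mu>')
    obtain f0 where f0: "\<And>z. z \<in> D \<Longrightarrow> (f0 has_field_derivative k z) (at z within D)"
      using holomorphic_convex_primitive'[OF D(2,1) holk] by blast
    define f where "f = (\<lambda>z. f0 z - f0 (-1) + h (-1))"
    have df: "(f has_field_derivative k z) (at z)" if "z \<in> D" for z
      unfolding f_def using f0[OF that] at_within_open[OF that D(1)]
      by (auto intro!: derivative_eq_intros)
    have holf: "f holomorphic_on D"
      using df D by (meson holomorphic_onI field_differentiable_at_within field_differentiable_def)
    have f_m1: "f (-1) = h (-1)" by (simp add: f_def)
    define F where "F = (\<lambda>z. f z - (h z + g (\<mu> z) - c))"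
    have holF: "F holomorphic_on D"
      unfolding F_def by (intro holomorphic_intros holf holh holg)
    have dF: "deriv F z = (exp (U z) - exp (p z)) + (exp (U z) - exp (q (\<mu> z))) * \<mu>' z"
      if z: "z \<in> D" for z
    proof -
      have 1: "(h has_field_derivative exp (p z)) (at z)"
        using holomorphic_derivI[OF h(2) open_ball DW(1)[OF z]] h(4)[OF DW(1)[OF z]] by simp
      have 2: "(g has_field_derivative exp (q (\<mu> z))) (at (\<mu> z))"
        using holomorphic_derivI[OF g(2) open_ball DW(4)[OF z]] g(4)[OF DW(4)[OF z]] by simp
      have 3: "((\<lambda>z. g (\<mu> z)) has_field_derivative exp (q (\<mu> z)) * \<mu>' z) (at z)"
        by (rule DERIV_chain2[OF 2 d\<mu>[OF DW(3)[OF z]]])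
      have "(F has_field_derivative k z - (exp (p z) + exp (q (\<mu> z)) * \<mu>' z - 0)) (at z)"
        unfolding F_def by (intro DERIV_diff DERIV_add df[OF z] 1 3 DERIV_const)
      then show ?thesis by (auto dest!: DERIV_imp_deriv simp: k_def algebra_simps)
    qed
    have \<mu>1: "norm (\<mu> z) \<le> 1" if "norm z \<le> 1" for z
      using norm_disc_dil_le[OF T that] by (simp add: \<mu>_def)
    have bF: "norm (deriv F z) \<le> B * (norm (cutoff t z) + norm (1 - cutoff t z) * norm (\<mu>' z))"
      if z: "norm z \<le> 1" for z
    proof -
      have s: "norm (cutoff t z) \<le> 1" "norm (1 - cutoff t z) \<le> 1"
        using norm_cutoff_le[of t z] z t by auto
      have e: "norm (exp (U z) - exp (p z)) \<le> B * norm (cutoff t z)"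
        "norm (exp (U z) - exp (q (\<mu> z))) \<le> B * norm (1 - cutoff t z)"
        unfolding U_def B_def
        using interpolated_exponent_bounds[OF M(1)[OF z] M(2)[OF \<mu>1[OF z]] s] by auto
      have "norm (deriv F z) \<le> norm (exp (U z) - exp (p z)) + norm (exp (U z) - exp (q (\<mu> z))) * norm (\<mu>' z)"
        unfolding dF[OF cD[OF z]] by (metis norm_mult norm_triangle_ineq)
      also have "\<dots> \<le> B * norm (cutoff t z) + B * norm (1 - cutoff t z) * norm (\<mu>' z)"
        using e by (intro add_mono mult_right_mono) auto
      finally show ?thesis by (simp add: algebra_simps)
    qed
    have \<mu>m1: "\<mu> (-1) = -1"
      using t by (simp add: \<mu>_def disc_dil_def dil_den_def T_def)
    have F_m1: "F (-1) = 0" using f_m1 \<mu>m1 hg by (simp add: F_def c_def)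
    \<comment> \<open>The estimate along rays reaches the open disc; continuity extends it to the circle.\<close>
    have "norm (F z) \<le> 8 * pi * B / sqrt t" if "norm z < 1" for z
      by (rule norm_bound_of_cutoff_deriv_bound[OF R(1) holF[unfolded D_def] F_m1 t B _ that])
        (use bF in \<open>simp add: \<mu>'_def T_def\<close>)
    moreover have "continuous_on (closure (ball 0 1)) F"
      using holF cD by (intro holomorphic_on_imp_continuous_on) (auto intro: holomorphic_on_subset)
    ultimately have F: "norm (F z) \<le> 8 * pi * B / sqrt t" if "norm z \<le> 1" for z
      using continuous_on_closure_norm_le[of "ball 0 1" F] that by auto
    have st: "sqrt t \<le> t" "sqrt t > 0" using t real_sqrt_le_iff[of t "t\<^sup>2"] by (auto simp: power2_eq_square)
    have Lt: "L * (2 / t) \<le> 2 * L / sqrt t"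
      using st t by (simp add: L_def frac_le)
    have near_h: "norm (f z - h z) \<le> C / sqrt t"
      if z: "norm z \<le> 1" "norm (1 + z) \<le> t * norm (1 - z)" for z
    proof -
      have z1: "norm (1 - z) > 0" using z t by (cases "z = 1") auto
      have "norm (\<mu> z - (-1)) = norm (2 * (1 + z) / dil_den T z)"
        unfolding \<mu>_def using one_plus_disc_dil[of T z] dil_den_nonzero[OF T z(1)] by (simp add: add.commute)
      also have "\<dots> = 2 * norm (1 + z) / norm (dil_den T z)"
        by (simp only: norm_divide norm_mult norm_numeral)
      also have "\<dots> \<le> 2 * (t * norm (1 - z)) / (T * norm (1 - z))"
        using z z1 T t norm_dil_den_ge'(2)[OF T z(1)] by (intro frac_le) auto
      also have "\<dots> = 2 / t" using z1 t by (simp add: T_def power2_eq_square)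
      finally have "norm (\<mu> z - (-1)) \<le> 2 / t" .
      then have "L * norm (\<mu> z - (-1)) \<le> L * (2 / t)" by (intro mult_left_mono) (auto simp: L_def)
      then have "norm (g (\<mu> z) - c) \<le> 2 * L / sqrt t"
        using lip(2)[OF \<mu>1[OF z(1)], of "-1"] hg Lt by (simp add: c_def)
      moreover have "norm (f z - h z) \<le> norm (F z) + norm (g (\<mu> z) - c)"
      proof -
        have "f z - h z = F z + (g (\<mu> z) - c)" by (simp add: F_def)
        then show ?thesis by (simp only: norm_triangle_ineq)
      qed
      ultimately have "norm (f z - h z) \<le> 8 * pi * B / sqrt t + 2 * L / sqrt t"
        using F[OF z(1)] by linarith
      then show ?thesis by (simp add: C_def add_divide_distrib)
    qed
    have near_g: "norm (f z - g (\<mu> z)) \<le> C / sqrt t"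
      if z: "norm z \<le> 1" "norm (1 + z) \<ge> t * norm (1 - z)" for z
    proof -
      have "norm (1 + z) \<le> 2" using norm_triangle_ineq[of 1 z] z by simp
      then have "t * norm (1 - z) \<le> 2" using z by simp
      then have "norm (z - 1) \<le> 2 / t" using t by (simp add: field_simps norm_minus_commute)
      then have "L * norm (z - 1) \<le> L * (2 / t)" by (intro mult_left_mono) (auto simp: L_def)
      then have "norm (h z - c) \<le> 2 * L / sqrt t"
        using lip(1)[OF z(1), of 1] Lt by (simp add: c_def)
      moreover have "norm (f z - g (\<mu> z)) \<le> norm (F z) + norm (h z - c)"
      proof -
        have "f z - g (\<mu> z) = F z + (h z - c)" by (simp add: F_def)
        then show ?thesis by (simp only: norm_triangle_ineq)
      qed
      ultimately have "norm (f z - g (\<mu> z)) \<le> 8 * pi * B / sqrt t + 2 * L / sqrt t"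
        using F[OF z(1)] by linarith
      then show ?thesis by (simp add: C_def add_divide_distrib)
    qed
    have "norm (f z) < 1" if z: "norm z \<le> 1" for z
    proof (cases "norm (1 + z) \<le> t * norm (1 - z)")
      case True
      then show ?thesis
        using near_h[OF z] \<rho>(1)[OF z] Ct norm_triangle_sub[of "f z" "h z"] by linarith
    next
      case False
      then show ?thesis
        using near_g[OF z] \<rho>(2)[OF \<mu>1[OF z]] Ct norm_triangle_sub[of "f z" "g (\<mu> z)"] by linarith
    qed
    moreover have "deriv f z \<noteq> 0" if "z \<in> D" for z
      using DERIV_imp_deriv[OF df[OF that]] DW(5)[OF that] by (simp add: k_def)
    ultimately have "f \<in> strict_loc_univalent"
      using R(1) holf unfolding strict_loc_univalent_def D_def by auto
    then show "\<exists>f\<in>strict_loc_univalent. f (-1) = h (-1) \<and>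
         (\<forall>z. norm z \<le> 1 \<longrightarrow> norm (1 + z) \<le> t * norm (1 - z) \<longrightarrow> norm (f z - h z) \<le> C / sqrt t) \<and>
         (\<forall>z. norm z \<le> 1 \<longrightarrow> norm (1 + z) \<ge> t * norm (1 - z) \<longrightarrow> norm (f z - g (disc_dil (t\<^sup>2) z)) \<le> C / sqrt t)"
      using f_m1 near_h near_g unfolding \<mu>_def T_def by blast
  qed
qed

text \<open>
  The condition \<open>t \<ge> (1 + r) / (1 - r)\<close> places \<open>cball 0 r\<close> in the part \<open>|\<zeta>| \<le> t\<close> of the disc and
  its image under the inverse dilation \<open>\<zeta> \<mapsto> t\<^sup>2 \<zeta>\<close> in the part \<open>|\<zeta>| \<ge> t\<close>.
\<close>

lemma gluing:
  assumes h: "h \<in> strict_loc_univalent" and g: "g \<in> strict_loc_univalent" and hg: "h 1 = g (-1)"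
    and r: "r < 1" and e: "e > 0"
  obtains f T where "f \<in> strict_loc_univalent" "T > 0" "f (-1) = h (-1)"
    "\<And>z. norm z \<le> r \<Longrightarrow> norm (f z - h z) < e"
    "\<And>z. norm z \<le> r \<Longrightarrow> norm (f (disc_dil (1 / T) z) - g z) < e"
proof -
  obtain C m where m: "m > 0" and glue: "\<And>t. t > 1 \<Longrightarrow> C / sqrt t < m \<Longrightarrow>
       \<exists>f\<in>strict_loc_univalent. f (-1) = h (-1) \<and>
         (\<forall>z. norm z \<le> 1 \<longrightarrow> norm (1 + z) \<le> t * norm (1 - z) \<longrightarrow> norm (f z - h z) \<le> C / sqrt t) \<and>
         (\<forall>z. norm z \<le> 1 \<longrightarrow> norm (1 + z) \<ge> t * norm (1 - z) \<longrightarrow> norm (f z - g (disc_dil (t\<^sup>2) z)) \<le> C / sqrt t)"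
    using gluing_rate[OF assms(1-3)] by metis
  define x where "x = max 2 (max ((1 + r) / (1 - r)) (\<bar>C\<bar> / min e m + 1))"
  have x: "x \<ge> 2" "x \<ge> (1 + r) / (1 - r)" "x > \<bar>C\<bar> / min e m"
    by (auto simp: x_def)
  define t where "t = x\<^sup>2"
  have st: "sqrt t = x" using x by (simp add: t_def)
  have "x * 1 \<le> x * x" using x(1) by (intro mult_left_mono) auto
  then have tx: "t \<ge> x" by (simp add: t_def power2_eq_square)
  have t: "t > 1" using tx x by linarith
  have "\<bar>C\<bar> < x * min e m" using x(3) m e by (simp add: field_simps)
  then have "\<bar>C\<bar> / x < min e m" using x(1) by (subst pos_divide_less_eq) (auto simp: mult.commute)
  moreover have "C / x \<le> \<bar>C\<bar> / x" using x(1) by (intro divide_right_mono) auto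
  ultimately have Ct: "C / sqrt t < m" "C / sqrt t < e" unfolding st by linarith+
  obtain f where f: "f \<in> strict_loc_univalent" "f (-1) = h (-1)"
      "\<And>z. norm z \<le> 1 \<Longrightarrow> norm (1 + z) \<le> t * norm (1 - z) \<Longrightarrow> norm (f z - h z) \<le> C / sqrt t"
      "\<And>z. norm z \<le> 1 \<Longrightarrow> norm (1 + z) \<ge> t * norm (1 - z) \<Longrightarrow> norm (f z - g (disc_dil (t\<^sup>2) z)) \<le> C / sqrt t"
    using glue[OF t Ct(1)] by metis
  have t2: "t\<^sup>2 > 0" using t by simp
  have xr: "1 + r \<le> t * (1 - r)"
  proof -
    have "(1 + r) / (1 - r) \<le> t" using x(2) tx by linarith
    then show ?thesis using r by (simp add: pos_divide_le_eq)
  qed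
  have zr: "norm (1 + z) \<le> t * norm (1 - z)" "norm (1 - z) \<le> t * norm (1 + z)" if "norm z \<le> r" for z :: complex
  proof -
    have "norm (1 + z) \<le> 1 + r" "norm (1 - z) \<le> 1 + r" "1 - r \<le> norm (1 + z)" "1 - r \<le> norm (1 - z)"
      using that norm_triangle_ineq[of 1 z] norm_triangle_ineq4[of 1 z]
        norm_triangle_ineq2[of 1 z] norm_triangle_ineq2[of 1 "-z"] by auto
    moreover from this have "t * (1 - r) \<le> t * norm (1 + z)" "t * (1 - r) \<le> t * norm (1 - z)"
      using t by (auto intro!: mult_left_mono)
    ultimately show "norm (1 + z) \<le> t * norm (1 - z)" "norm (1 - z) \<le> t * norm (1 + z)"
      using xr by linarith+
  qed
  have near_g: "norm (f (disc_dil (1 / t\<^sup>2) z) - g z) < e" if z: "norm z \<le> r" for z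
  proof -
    define w where "w = disc_dil (1 / t\<^sup>2) z"
    have z1: "norm z \<le> 1" using z r by simp
    have d: "dil_den (1 / t\<^sup>2) z \<noteq> 0" using dil_den_nonzero[of "1 / t\<^sup>2" z] t2 z1 by simp
    have w1: "norm w \<le> 1" using norm_disc_dil_le[of "1 / t\<^sup>2" z] t2 z1 by (simp add: w_def)
    have "disc_dil (t\<^sup>2) w = z" using disc_dil_inverse[of "1 / t\<^sup>2" z] t2 z1 by (simp add: w_def)
    moreover have "t * norm (1 - w) \<le> norm (1 + w)"
    proof -
      have "t * norm (1 - w) = 2 * (1 / t * norm (1 - z)) / norm (dil_den (1 / t\<^sup>2) z)"
        using t unfolding w_def one_minus_disc_dil[OF d] by (simp add: norm_divide norm_mult power2_eq_square del: right_diff_distrib_numeral)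
      also have "\<dots> \<le> 2 * norm (1 + z) / norm (dil_den (1 / t\<^sup>2) z)"
        using zr(2)[OF z] t by (intro divide_right_mono mult_left_mono) (auto simp: field_simps)
      also have "\<dots> = norm (1 + w)"
        unfolding w_def one_plus_disc_dil[OF d] by (simp only: norm_divide norm_mult norm_numeral)
      finally show ?thesis .
    qed
    ultimately show ?thesis using f(4)[OF w1] Ct(2) by (simp add: w_def)
  qed
  show ?thesis
  proof (rule that[of f "t\<^sup>2"])
    show "norm (f z - h z) < e" if "norm z \<le> r" for z
    proof -
      have "norm z \<le> 1" using that r by simp
      from f(3)[OF this zr(1)[OF that]] Ct(2) show ?thesis by simp
    qed
  qed (use f t2 near_g in auto)
qed

section \<open>Approximating two functions by one\<close>

text \<open>
  The function \<open>Ln ((1 + k z) / (1 - k z))\<close> maps the disc into a strip of bounded width, and its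
  values at \<open>1\<close> and \<open>-1\<close> are \<open>l\<close> and \<open>-l\<close>, with \<open>l\<close> tending to infinity as \<open>k\<close> tends to
  \<open>1\<close>. Divided by \<open>l\<close> it is univalent with values close to the segment \<open>[-1, 1]\<close>, which an
  affine map takes to the segment from \<open>a\<close> to \<open>b\<close>. That segment lies in the disc by convexity.
\<close>

lemma connector_exists:
  assumes ab: "a \<noteq> b" "norm a < 1" "norm (b::complex) < 1"
  obtains m where "m \<in> strict_loc_univalent" "m (-1) = a" "m 1 = b"
proof -
  define \<rho> where "\<rho> = max (norm a) (norm b)"
  have \<rho>: "\<rho> < 1" "norm a \<le> \<rho>" "norm b \<le> \<rho>" using ab by (auto simp: \<rho>_def)
  define X where "X = pi / (1 - \<rho>) + 1"
  have X: "X > 0" "pi / X < 1 - \<rho>"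
  proof -
    show X0: "X > 0" using \<rho> by (simp add: X_def add_pos_pos)
    have "pi / (1 - \<rho>) < X" by (simp add: X_def)
    then show "pi / X < 1 - \<rho>" using X0 \<rho> by (simp add: field_simps)
  qed
  define k where "k = 1 - exp (- X)"
  have k: "0 < k" "k < 1" using X by (auto simp: k_def)
  define l where "l = ln (1 + k) - ln (1 - k)"
  have "ln (1 - k) = - X" by (simp add: k_def)
  moreover have "ln (1 + k) \<ge> 0" using k by simp
  ultimately have lX: "l \<ge> X" by (simp add: l_def)
  then have l: "l > 0" using X by simp
  define \<tau> where "\<tau> = (\<lambda>z. (Ln (1 + of_real k * z) - Ln (1 - of_real k * z)) / of_real l)"
  define m where "m = (\<lambda>z. (a + b) / 2 + (b - a) / 2 * \<tau> z)"
  have Re_pos: "Re (1 + of_real k * z) > 0" "Re (1 - of_real k * z) > 0" if "z \<in> ball 0 (1 / k)" for z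
  proof -
    have "norm (of_real k * z) < 1" using that k by (simp add: norm_mult field_simps)
    then have "\<bar>Re (of_real k * z)\<bar> < 1" using abs_Re_le_cmod[of "of_real k * z"] by linarith
    then show "Re (1 + of_real k * z) > 0" "Re (1 - of_real k * z) > 0" by auto
  qed
  have dm: "(m has_field_derivative (b - a) / 2 * (2 * of_real k / ((1 + of_real k * z) * (1 - of_real k * z)) / of_real l)) (at z)"
    if z: "z \<in> ball 0 (1 / k)" for z
  proof -
    have n: "1 + of_real k * z \<notin> \<real>\<^sub>\<le>\<^sub>0" "1 - of_real k * z \<notin> \<real>\<^sub>\<le>\<^sub>0"
      using Re_pos[OF z] by (auto simp: complex_nonpos_Reals_iff)
    have n0: "1 + of_real k * z \<noteq> 0" "1 - of_real k * z \<noteq> 0"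
      using Re_pos[OF z] by (metis less_irrefl zero_complex.simps(1))+
    have "((\<lambda>z. Ln (1 + of_real k * z) - Ln (1 - of_real k * z)) has_field_derivative
        of_real k / (1 + of_real k * z) + of_real k / (1 - of_real k * z)) (at z)"
      using n n0 by (auto intro!: derivative_eq_intros simp: divide_inverse mult.commute)
    moreover have "of_real k / (1 + of_real k * z) + of_real k / (1 - of_real k * z)
        = 2 * of_real k / ((1 + of_real k * z) * (1 - of_real k * z))"
      using n0 by (simp add: add_frac_eq) (simp add: algebra_simps)
    ultimately have "((\<lambda>z. Ln (1 + of_real k * z) - Ln (1 - of_real k * z)) has_field_derivative
        2 * of_real k / ((1 + of_real k * z) * (1 - of_real k * z))) (at z)" by metis
    then have "(m has_field_derivative 0 + (b - a) / 2 * (2 * of_real k / ((1 + of_real k * z) * (1 - of_real k * z)) / of_real l)) (at z)"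
      unfolding m_def \<tau>_def by (intro DERIV_add DERIV_const DERIV_cmult DERIV_cdivide)
    then show ?thesis by (simp only: add_0_left)
  qed
  have "m \<in> strict_loc_univalent"
    unfolding strict_loc_univalent_def
  proof (intro CollectI exI[of _ "1 / k"] conjI ballI)
    show "1 / k > 1" using k by simp
    show "m holomorphic_on ball 0 (1 / k)"
      using dm by (meson holomorphic_onI field_differentiable_at_within field_differentiable_def)
    show "deriv m z \<noteq> 0" if z: "z \<in> ball 0 (1 / k)" for z
    proof -
      have n0: "1 + of_real k * z \<noteq> 0" "1 - of_real k * z \<noteq> 0"
        using Re_pos[OF z] by (metis less_irrefl zero_complex.simps(1))+
      then show ?thesis using DERIV_imp_deriv[OF dm[OF z]] ab k l by simp
    qed
    show "norm (m z) < 1" if z: "z \<in> cball 0 1" for z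
    proof -
      have zk: "norm (of_real k * z) \<le> k" using z k by (simp add: norm_mult mult_left_le)
      have "1 < 1 / k" using k by simp
      then have zb: "z \<in> ball 0 (1 / k)" using z by simp
      define u v where "u = 1 + of_real k * z" and "v = 1 - of_real k * z"
      have uv: "Re u > 0" "Re v > 0" using Re_pos[OF zb] by (auto simp: u_def v_def)
      then have uv0: "u \<noteq> 0" "v \<noteq> 0" by auto
      have "1 - k \<le> norm u" "norm u \<le> 1 + k" "1 - k \<le> norm v" "norm v \<le> 1 + k"
        using zk norm_triangle_ineq[of 1 "of_real k * z"] norm_triangle_ineq4[of 1 "of_real k * z"]
          norm_triangle_ineq2[of 1 "- (of_real k * z)"] norm_triangle_ineq2[of 1 "of_real k * z"]
        unfolding u_def v_def by auto
      then have "ln (1 - k) \<le> ln (norm u)" "ln (norm u) \<le> ln (1 + k)"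
          "ln (1 - k) \<le> ln (norm v)" "ln (norm v) \<le> ln (1 + k)"
        using k uv0 by auto
      then have Re: "\<bar>Re (Ln u - Ln v)\<bar> \<le> l" using uv0 by (auto simp: l_def)
      have "\<bar>Im (Ln u)\<bar> < pi / 2" "\<bar>Im (Ln v)\<bar> < pi / 2" using uv uv0 Re_Ln_pos_lt[of u] Re_Ln_pos_lt[of v] by blast+
      then have Im: "\<bar>Im (Ln u - Ln v)\<bar> \<le> pi" by auto
      define x y where "x = Re (\<tau> z)" and "y = Im (\<tau> z)"
      have xy: "x = Re (Ln u - Ln v) / l" "y = Im (Ln u - Ln v) / l"
        by (simp_all add: x_def y_def \<tau>_def u_def v_def)
      have x: "\<bar>x\<bar> \<le> 1" using Re l unfolding xy by (simp add: abs_divide)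
      have "\<bar>y\<bar> \<le> pi / l" using Im l unfolding xy by (simp add: abs_divide divide_right_mono)
      also have "\<dots> \<le> pi / X" using lX X by (simp add: frac_le)
      finally have y: "\<bar>y\<bar> < 1 - \<rho>" using X by linarith
      have "\<tau> z = of_real x + \<i> * of_real y" by (simp add: x_def y_def complex_eq)
      then have "m z = of_real ((1 - x) / 2) * a + of_real ((1 + x) / 2) * b + (b - a) / 2 * (\<i> * of_real y)"
        by (simp add: m_def field_simps)
      then have "norm (m z) \<le> norm (of_real ((1 - x) / 2) * a) + norm (of_real ((1 + x) / 2) * b) + norm ((b - a) / 2 * (\<i> * of_real y))"
        by (metis norm_triangle_ineq norm_triangle_le add_mono order_refl)
      also have "norm (of_real ((1 - x) / 2) * a) = (1 - x) / 2 * norm a"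
        using x by (simp only: norm_mult norm_of_real) auto
      also have "norm (of_real ((1 + x) / 2) * b) = (1 + x) / 2 * norm b"
        using x by (simp only: norm_mult norm_of_real) auto
      also have "norm ((b - a) / 2 * (\<i> * of_real y)) = norm (b - a) / 2 * \<bar>y\<bar>"
        by (simp add: norm_mult norm_divide)
      also have "(1 - x) / 2 * norm a + (1 + x) / 2 * norm b + norm (b - a) / 2 * \<bar>y\<bar>
          \<le> (1 - x) / 2 * \<rho> + (1 + x) / 2 * \<rho> + 1 * \<bar>y\<bar>"
        using x \<rho> ab norm_triangle_ineq4[of b a]
        by (intro add_mono mult_left_mono mult_right_mono) auto
      also have "\<dots> = \<rho> + \<bar>y\<bar>" by (simp add: field_simps)
      finally show ?thesis using y by linarith
    qed
  qed
  moreover have "\<tau> 1 = 1" "\<tau> (-1) = -1"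
  proof -
    have "Ln (1 + of_real k) = of_real (ln (1 + k))" "Ln (1 - of_real k) = of_real (ln (1 - k))"
      using k Ln_of_real[of "1 + k"] Ln_of_real[of "1 - k"] by simp_all
    then show "\<tau> 1 = 1" "\<tau> (-1) = -1"
      using l by (auto simp: \<tau>_def l_def field_simps)
  qed
  then have "m (-1) = a" "m 1 = b" by (simp_all add: m_def field_simps)
  ultimately show ?thesis using that by blast
qed

text \<open>
  Membership constrains the values inside the disc only, so that the total functions \<open>disc_dil T\<close>
  belong to this set as they are.
\<close>

definition disc_auts :: "(complex \<Rightarrow> complex) set" where
  "disc_auts = {\<phi>. \<phi> holomorphic_on ball 0 1 \<and> (\<forall>z\<in>ball 0 1. \<phi> z \<in> ball 0 1) \<and>
     (\<exists>\<kappa>. \<kappa> holomorphic_on ball 0 1 \<and> (\<forall>z\<in>ball 0 1. \<kappa> z \<in> ball 0 1) \<and>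
        (\<forall>z\<in>ball 0 1. \<kappa> (\<phi> z) = z \<and> \<phi> (\<kappa> z) = z))}"

lemma disc_dil_holomorphic: "T > 0 \<Longrightarrow> disc_dil T holomorphic_on ball 0 1"
  unfolding disc_dil_def dil_den_def[abs_def]
  by (intro holomorphic_intros) (use dil_den_nonzero[of T] in \<open>auto simp: dil_den_def\<close>)

lemma disc_dil_in_disc_auts:
  assumes "T > 0"
  shows "disc_dil T \<in> disc_auts"
  unfolding disc_auts_def
proof (intro CollectI conjI exI[of _ "disc_dil (1 / T)"] ballI)
  show "disc_dil T (disc_dil (1 / T) z) = z" if "z \<in> ball 0 1" for z
    using disc_dil_inverse[of "1 / T" z] assms that by simp
  show "disc_dil (1 / T) (disc_dil T z) = z" if "z \<in> ball 0 1" for z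
    using disc_dil_inverse[of T z] assms that by simp
qed (use assms norm_disc_dil_less[of T] norm_disc_dil_less[of "1 / T"] in \<open>auto intro!: disc_dil_holomorphic\<close>)

lemma disc_auts_compose:
  assumes "\<phi> \<in> disc_auts" "\<psi> \<in> disc_auts"
  shows "\<phi> \<circ> \<psi> \<in> disc_auts"
proof -
  let ?D = "ball (0::complex) 1"
  obtain \<kappa> where 1: "\<phi> holomorphic_on ?D" "\<forall>z\<in>?D. \<phi> z \<in> ?D" "\<kappa> holomorphic_on ?D" "\<forall>z\<in>?D. \<kappa> z \<in> ?D"
      "\<forall>z\<in>?D. \<kappa> (\<phi> z) = z \<and> \<phi> (\<kappa> z) = z"
    using assms(1) unfolding disc_auts_def by blast
  obtain \<eta> where 2: "\<psi> holomorphic_on ?D" "\<forall>z\<in>?D. \<psi> z \<in> ?D" "\<eta> holomorphic_on ?D" "\<forall>z\<in>?D. \<eta> z \<in> ?D"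
      "\<forall>z\<in>?D. \<eta> (\<psi> z) = z \<and> \<psi> (\<eta> z) = z"
    using assms(2) unfolding disc_auts_def by blast
  have "(\<phi> \<circ> \<psi>) holomorphic_on ?D" "(\<eta> \<circ> \<kappa>) holomorphic_on ?D"
    using 1 2 by (auto intro!: holomorphic_on_compose_gen[of _ _ _ ?D])
  then show ?thesis
    unfolding disc_auts_def using 1 2 by (intro CollectI conjI exI[of _ "\<eta> \<circ> \<kappa>"]) auto
qed

lemma disc_aut_image_bound:
  assumes "\<phi> \<in> disc_auts" "r < 1"
  obtains r' where "r' < 1" "\<And>z. norm z \<le> r \<Longrightarrow> norm (\<phi> z) \<le> r'"
proof (cases "r \<ge> 0")
  case True
  have \<phi>: "\<phi> holomorphic_on ball 0 1" "\<forall>z\<in>ball 0 1. \<phi> z \<in> ball 0 1"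
    using assms(1) unfolding disc_auts_def by auto
  have sub: "cball (0::complex) r \<subseteq> ball 0 1" using assms(2) by auto
  have "continuous_on (cball 0 r) (\<lambda>z. norm (\<phi> z))"
    using \<phi>(1) sub by (intro continuous_on_norm) (meson continuous_on_subset holomorphic_on_imp_continuous_on)
  then obtain x where x: "x \<in> cball 0 r" "\<forall>y\<in>cball 0 r. norm (\<phi> y) \<le> norm (\<phi> x)"
    using continuous_attains_sup[of "cball (0::complex) r" "\<lambda>z. norm (\<phi> z)"] True by auto
  show ?thesis
    using that[of "norm (\<phi> x)"] x \<phi>(2) sub by auto
next
  case False
  then show ?thesis using that[of 0] by (metis norm_ge_zero order_trans zero_less_one)
qed

text \<open>
  If \<open>h 1 \<noteq> g (-1)\<close>, the connector \<open>m\<close> is first glued to \<open>g\<close>. The result \<open>f1\<close> keeps the value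
  \<open>h 1\<close> at \<open>-1\<close>, so that \<open>h\<close> can be glued to \<open>f1\<close>. The second gluing has to be accurate on the
  compact set on which \<open>f1\<close> resembles \<open>g\<close>, which is what \<open>r'\<close> takes care of.
\<close>

lemma approximate_two_functions:
  assumes h: "h \<in> strict_loc_univalent" and g: "g \<in> strict_loc_univalent" and r: "r < 1" and e: "e > 0"
  obtains f \<phi> where "f \<in> strict_loc_univalent" "\<phi> \<in> disc_auts"
    "\<And>z. norm z \<le> r \<Longrightarrow> norm (f z - h z) < e"
    "\<And>z. norm z \<le> r \<Longrightarrow> norm (f (\<phi> z) - g z) < e"
proof (cases "h 1 = g (-1)")
  case True
  from gluing[OF h g this r e] obtain f T where
    "f \<in> strict_loc_univalent" "T > 0"
    "\<And>z. norm z \<le> r \<Longrightarrow> norm (f z - h z) < e"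
    "\<And>z. norm z \<le> r \<Longrightarrow> norm (f (disc_dil (1 / T) z) - g z) < e" by metis
  then show ?thesis using that[of f "disc_dil (1 / T)"] disc_dil_in_disc_auts[of "1 / T"] by simp
next
  case False
  have "norm (h 1) < 1" "norm (g (-1)) < 1" using h g by (auto simp: strict_loc_univalent_def)
  then obtain m where m: "m \<in> strict_loc_univalent" "m (-1) = h 1" "m 1 = g (-1)"
    using connector_exists[OF False] by metis
  have e2: "e / 2 > 0" using e by simp
  from gluing[OF m(1) g m(3) r e2] obtain f1 T1 where
    f1: "f1 \<in> strict_loc_univalent" "T1 > 0" "f1 (-1) = m (-1)"
      "\<And>z. norm z \<le> r \<Longrightarrow> norm (f1 (disc_dil (1 / T1) z) - g z) < e / 2" by metis
  have a1: "disc_dil (1 / T1) \<in> disc_auts" using f1 by (intro disc_dil_in_disc_auts) simp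
  obtain r' where r': "r' < 1" "\<And>z. norm z \<le> r \<Longrightarrow> norm (disc_dil (1 / T1) z) \<le> r'"
    using disc_aut_image_bound[OF a1 r] by metis
  have hf: "h 1 = f1 (-1)" using m f1 by simp
  have r2: "max r r' < 1" using r r' by simp
  from gluing[OF h f1(1) hf r2 e2] obtain f T where
    f: "f \<in> strict_loc_univalent" "T > 0"
      "\<And>z. norm z \<le> max r r' \<Longrightarrow> norm (f z - h z) < e / 2"
      "\<And>z. norm z \<le> max r r' \<Longrightarrow> norm (f (disc_dil (1 / T) z) - f1 z) < e / 2" by metis
  have a2: "disc_dil (1 / T) \<in> disc_auts" using f by (intro disc_dil_in_disc_auts) simp
  show ?thesis
  proof (rule that[of f "disc_dil (1 / T) \<circ> disc_dil (1 / T1)"])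
    show "disc_dil (1 / T) \<circ> disc_dil (1 / T1) \<in> disc_auts" by (rule disc_auts_compose[OF a2 a1])
    show "norm (f z - h z) < e" if "norm z \<le> r" for z
    proof -
      have "norm (f z - h z) < e / 2" using that by (intro f(3)) simp
      then show ?thesis using e by linarith
    qed
    show "norm (f ((disc_dil (1 / T) \<circ> disc_dil (1 / T1)) z) - g z) < e" if z: "norm z \<le> r" for z
    proof -
      let ?w = "disc_dil (1 / T1) z"
      have "norm (f (disc_dil (1 / T) ?w) - f1 ?w) < e / 2" using f(4)[of ?w] r'(2)[OF z] by simp
      with f1(4)[OF z] have "norm (f (disc_dil (1 / T) ?w) - g z) < e"
        using norm_triangle_ineq[of "f (disc_dil (1 / T) ?w) - f1 ?w" "f1 ?w - g z"] by simp
      then show ?thesis by simp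
    qed
  qed (use f in auto)
qed

section \<open>Density and separability\<close>

text \<open>
  The approximants are \<open>s f (s z)\<close> with \<open>s < 1\<close> close to \<open>1\<close>; the outer factor makes the bound
  strict.
\<close>

lemma strict_loc_univalent_approximates:
  assumes f: "f holomorphic_on ball 0 1" "\<And>z. z \<in> ball 0 1 \<Longrightarrow> norm (f z) \<le> 1"
      "\<And>z. z \<in> ball 0 1 \<Longrightarrow> deriv f z \<noteq> 0"
    and r: "r < 1" and e: "e > 0"
  shows "\<exists>g\<in>strict_loc_univalent. \<forall>z. norm z \<le> r \<longrightarrow> norm (g z - f z) < e"
proof -
  have sub: "cball (0::complex) r \<subseteq> ball 0 1" using r by auto
  have "uniformly_continuous_on (cball 0 r) f"
    using f(1) sub by (meson compact_cball compact_uniformly_continuous continuous_on_subset holomorphic_on_imp_continuous_on)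
  then obtain d where d: "d > 0" "\<And>x y. x \<in> cball 0 r \<Longrightarrow> y \<in> cball 0 r \<Longrightarrow> dist y x < d \<Longrightarrow> dist (f y) (f x) < e / 2"
    using e unfolding uniformly_continuous_on_def by (metis half_gt_zero)
  define s where "s = 1 - min (min (d / 2) (e / 2)) (1 / 2)"
  have s: "0 < s" "s < 1" "1 - s < d" "1 - s \<le> e / 2" using d(1) e by (auto simp: s_def min_def)
  define g where "g = (\<lambda>z. of_real s * f (of_real s * z))"
  have in_ball: "of_real s * z \<in> ball 0 1" if "z \<in> ball 0 (1 / s)" for z :: complex
    using that s by (simp add: norm_mult field_simps)
  have dg: "(g has_field_derivative of_real s * (deriv f (of_real s * z) * of_real s)) (at z)"
    if z: "z \<in> ball 0 (1 / s)" for z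
  proof -
    have 1: "((\<lambda>z. of_real s * z) has_field_derivative of_real s) (at z)"
      by (auto intro!: derivative_eq_intros)
    show ?thesis unfolding g_def
      by (intro DERIV_cmult DERIV_chain2[OF holomorphic_derivI[OF f(1) open_ball in_ball[OF z]] 1])
  qed
  have "g \<in> strict_loc_univalent"
    unfolding strict_loc_univalent_def
  proof (intro CollectI exI[of _ "1 / s"] conjI ballI)
    show "1 / s > 1" using s by simp
    show "g holomorphic_on ball 0 (1 / s)"
      using dg by (meson holomorphic_onI field_differentiable_at_within field_differentiable_def)
    show "deriv g z \<noteq> 0" if z: "z \<in> ball 0 (1 / s)" for z
      using DERIV_imp_deriv[OF dg[OF z]] f(3)[OF in_ball[OF z]] s by simp
    show "norm (g z) < 1" if z: "z \<in> cball 0 1" for z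
    proof -
      have "1 < 1 / s" using s by simp
      then have "z \<in> ball 0 (1 / s)" using z by simp
      then have "norm (f (of_real s * z)) \<le> 1" using f(2) in_ball by blast
      then have "s * norm (f (of_real s * z)) \<le> s * 1" using s by (intro mult_left_mono) auto
      moreover have "norm (g z) = s * norm (f (of_real s * z))" using s by (simp add: g_def norm_mult)
      ultimately show ?thesis using s by linarith
    qed
  qed
  moreover have "norm (g z - f z) < e" if z: "norm z \<le> r" for z
  proof -
    have "s * norm z \<le> 1 * norm z" using s by (intro mult_right_mono) auto
    then have sz: "norm (of_real s * z) \<le> r" using z s by (simp add: norm_mult)
    have "of_real s * z - z = - (of_real (1 - s) * z)" by (simp add: algebra_simps)
    then have "dist (of_real s * z) z = (1 - s) * norm z"
      unfolding dist_norm using s by (simp only: norm_minus_cancel norm_mult norm_of_real)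
    also have "\<dots> \<le> (1 - s) * 1" using s z r by (intro mult_left_mono) auto
    finally have "dist (f (of_real s * z)) (f z) < e / 2"
      using d(2)[of z "of_real s * z"] z sz s by auto
    moreover have "norm (f (of_real s * z)) \<le> 1" using f(2) sz r by simp
    then have "(1 - s) * norm (f (of_real s * z)) \<le> 1 - s" using s by (intro mult_left_le) auto
    moreover have "norm (g z - f z) \<le> (1 - s) * norm (f (of_real s * z)) + dist (f (of_real s * z)) (f z)"
    proof -
      have "g z - f z = (f (of_real s * z) - f z) - of_real (1 - s) * f (of_real s * z)"
        by (simp add: g_def algebra_simps)
      then have "norm (g z - f z) \<le> norm (f (of_real s * z) - f z) + norm (of_real (1 - s) * f (of_real s * z))"
        by (metis norm_triangle_ineq4)
      then show ?thesis using s by (simp only: dist_norm norm_mult norm_of_real)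
    qed
    ultimately show ?thesis using s(4) by argo
  qed
  ultimately show ?thesis by blast
qed

lemma strict_loc_univalent_holomorphic:
  assumes "f \<in> strict_loc_univalent"
  shows "f holomorphic_on ball 0 1"
proof -
  obtain R where "R > 1" "f holomorphic_on ball 0 R" using assms unfolding strict_loc_univalent_def by blast
  then show ?thesis by (meson holomorphic_on_subset subset_ball less_imp_le)
qed

text \<open>
  Otherwise there would be an infinite sequence whose members have mutual distance at least \<open>e\<close> on
  \<open>cball 0 r\<close>, contrary to Montel's theorem.
\<close>

lemma strict_loc_univalent_totally_bounded:
  assumes r: "r < 1" and e: "e > 0"
  shows "\<exists>N. finite N \<and> N \<subseteq> strict_loc_univalent \<and>
    (\<forall>g\<in>strict_loc_univalent. \<exists>f\<in>N. \<forall>z. norm z \<le> r \<longrightarrow> norm (f z - g z) < e)"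
proof (rule ccontr)
  assume neg: "\<not> ?thesis"
  define P where "P = (\<lambda>(f :: nat \<Rightarrow> complex \<Rightarrow> complex) n g. g \<in> strict_loc_univalent \<and>
     (\<forall>i<n. \<exists>z. norm z \<le> r \<and> norm (f i z - g z) \<ge> e))"
  have "\<exists>f. \<forall>n. P f n (f n)"
  proof (rule dependent_wellorder_choice)
    show "\<exists>g. P f n g" if f: "\<And>i. i < n \<Longrightarrow> P f i (f i)" for f n
    proof -
      have "finite (f ` {..<n})" "f ` {..<n} \<subseteq> strict_loc_univalent" using f by (auto simp: P_def)
      then obtain g where "g \<in> strict_loc_univalent" "\<not> (\<exists>h\<in>f ` {..<n}. \<forall>z. norm z \<le> r \<longrightarrow> norm (h z - g z) < e)"
        using neg by blast
      then show ?thesis unfolding P_def by (auto simp: not_less intro!: exI[of _ g])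
    qed
  qed (auto simp: P_def)
  then obtain F :: "nat \<Rightarrow> complex \<Rightarrow> complex" where F: "\<And>n. F n \<in> strict_loc_univalent"
      "\<And>i n. i < n \<Longrightarrow> \<exists>z. norm z \<le> r \<and> norm (F i z - F n z) \<ge> e"
    unfolding P_def by blast
  have bnd: "\<exists>B. \<forall>h\<in>strict_loc_univalent. \<forall>z\<in>K. norm (h z) \<le> B" if "compact K" "K \<subseteq> ball 0 1" for K
    using that unfolding strict_loc_univalent_def by (intro exI[of _ 1]) (force simp: less_imp_le)
  obtain g \<sigma> where \<sigma>: "strict_mono (\<sigma> :: nat \<Rightarrow> nat)"
      and lim: "\<And>K. compact K \<Longrightarrow> K \<subseteq> ball 0 1 \<Longrightarrow> uniform_limit K (F \<circ> \<sigma>) g sequentially"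
  proof (rule Montel[OF open_ball strict_loc_univalent_holomorphic bnd])
    show "range F \<subseteq> strict_loc_univalent" using F(1) by blast
  qed (use that in blast)+
  have "uniform_limit (cball 0 r) (F \<circ> \<sigma>) g sequentially" using r by (intro lim) auto
  then obtain n where n: "\<And>k z. k \<ge> n \<Longrightarrow> z \<in> cball 0 r \<Longrightarrow> dist ((F \<circ> \<sigma>) k z) (g z) < e / 2"
    using e unfolding uniform_limit_iff eventually_sequentially by (metis half_gt_zero)
  have "\<sigma> n < \<sigma> (Suc n)" using \<sigma> by (simp add: strict_mono_def)
  then obtain z where z: "norm z \<le> r" "norm (F (\<sigma> n) z - F (\<sigma> (Suc n)) z) \<ge> e" using F(2) by blast
  have "dist (F (\<sigma> n) z) (g z) < e / 2" "dist (F (\<sigma> (Suc n)) z) (g z) < e / 2"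
    using n[of n z] n[of "Suc n" z] z by auto
  then have "dist (F (\<sigma> n) z) (F (\<sigma> (Suc n)) z) < e" by (metis dist_triangle_half_l)
  then show False using z by (simp add: dist_norm)
qed

text \<open>
  The union of finite nets for a sequence of radii tending to \<open>1\<close> is countable. The
  pairing function lists each member infinitely often, so that in the inductive construction
  each one also gets approximated at late stages, where the error tolerance is small.
\<close>

lemma strict_loc_univalent_recurrent_dense_sequence:
  "\<exists>E :: nat \<Rightarrow> complex \<Rightarrow> complex. range E \<subseteq> strict_loc_univalent \<and>
     (\<forall>g\<in>strict_loc_univalent. \<forall>r<1. \<forall>e>0. \<forall>m. \<exists>n\<ge>m. \<forall>z. norm z \<le> r \<longrightarrow> norm (E n z - g z) < e)"
proof -
  define R where "R = (\<lambda>k::nat. 1 - 1 / real (Suc k))"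
  have "\<forall>k. \<exists>N. finite N \<and> N \<subseteq> strict_loc_univalent \<and>
    (\<forall>g\<in>strict_loc_univalent. \<exists>f\<in>N. \<forall>z. norm z \<le> R k \<longrightarrow> norm (f z - g z) < 1 / real (Suc k))"
    by (intro allI strict_loc_univalent_totally_bounded) (auto simp: R_def)
  then obtain N where N: "\<And>k. finite (N k)" "\<And>k. N k \<subseteq> strict_loc_univalent"
    "\<And>k g. g \<in> strict_loc_univalent \<Longrightarrow> \<exists>f\<in>N k. \<forall>z. norm z \<le> R k \<longrightarrow> norm (f z - g z) < 1 / real (Suc k)"
    by metis
  define A where "A = (\<Union>k. N k)"
  have A: "countable A" "A \<subseteq> strict_loc_univalent" using N by (auto simp: A_def intro: countable_finite)
  obtain g0 where "g0 \<in> strict_loc_univalent" using connector_exists[of 0 "1/2"] by auto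
  then have "A \<noteq> {}" using N(3)[of g0 0] by (auto simp: A_def)
  then have ran: "range (from_nat_into A) = A" using A(1) by (simp add: range_from_nat_into)
  define E where "E = (\<lambda>n. from_nat_into A (fst (prod_decode n)))"
  show ?thesis
  proof (intro exI[of _ E] conjI ballI allI impI)
    show "range E \<subseteq> strict_loc_univalent" using ran A(2) by (auto simp: E_def)
    fix g :: "complex \<Rightarrow> complex" and r e :: real and m :: nat
    assume g: "g \<in> strict_loc_univalent" and r: "r < 1" and e: "e > 0"
    define \<delta> where "\<delta> = min (1 - r) e"
    have "\<delta> > 0" using r e by (simp add: \<delta>_def)
    then obtain k where k: "1 / real (Suc k) < \<delta>" using nat_approx_posE by blast
    obtain f where f: "f \<in> N k" "\<And>z. norm z \<le> R k \<Longrightarrow> norm (f z - g z) < 1 / real (Suc k)"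
      using N(3)[OF g] by blast
    have "f \<in> range (from_nat_into A)" using f(1) ran by (auto simp: A_def)
    then obtain i where i: "f = from_nat_into A i" by blast
    have "E (prod_encode (i, m)) = f" by (simp add: E_def i)
    moreover have "norm (f z - g z) < e" if "norm z \<le> r" for z
    proof -
      have "norm z \<le> R k" using that k by (simp add: R_def \<delta>_def)
      from f(2)[OF this] show ?thesis using k by (simp add: \<delta>_def)
    qed
    ultimately show "\<exists>n\<ge>m. \<forall>z. norm z \<le> r \<longrightarrow> norm (E n z - g z) < e"
      using le_prod_encode_2[of m i] by blast
  qed
qed

section \<open>A universal function on the disc\<close>

text \<open>
  Cauchy's inequality on discs of a fixed radius \<open>d\<close> around the points of \<open>K\<close>; the union \<open>L\<close> of
  these discs is compact.
\<close>

lemma uniform_limit_deriv: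
  fixes F :: "nat \<Rightarrow> complex \<Rightarrow> complex"
  assumes S: "open S" and F: "\<And>n. F n holomorphic_on S" and f: "f holomorphic_on S"
    and lim: "\<And>K. compact K \<Longrightarrow> K \<subseteq> S \<Longrightarrow> uniform_limit K F f sequentially"
    and K: "compact K" "K \<subseteq> S"
  shows "uniform_limit K (\<lambda>n. deriv (F n)) (deriv f) sequentially"
proof -
  obtain d where d: "d > 0" "(\<Union>x\<in>K. cball x d) \<subseteq> S"
    using compact_subset_open_imp_cball_epsilon_subset[OF K(1) S K(2)] by blast
  define L where "L = (\<Union>x\<in>K. \<Union>y\<in>cball 0 d. {x + y})"
  have "compact L" unfolding L_def using compact_sums'[OF K(1) compact_cball, of 0 d] .
  moreover have ballL: "cball x d \<subseteq> L" if "x \<in> K" for x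
  proof
    fix w assume "w \<in> cball x d"
    then have "w - x \<in> cball 0 d" by (simp add: dist_norm norm_minus_commute)
    then show "w \<in> L" using that unfolding L_def by (intro UN_I[of x K] UN_I[of "w - x"]) auto
  qed
  moreover have "L \<subseteq> S"
  proof
    fix w assume "w \<in> L"
    then obtain x y where xy: "x \<in> K" "y \<in> cball 0 d" "w = x + y" unfolding L_def by blast
    then have "w \<in> cball x d" by (simp add: dist_norm)
    then show "w \<in> S" using d(2) xy(1) by blast
  qed
  ultimately have ul: "uniform_limit L F f sequentially" using lim by blast
  show ?thesis
    unfolding uniform_limit_iff
  proof (intro allI impI)
    fix e :: real assume e: "e > 0"
    then have "e * d / 2 > 0" using d(1) by simp
    then have "\<forall>\<^sub>F n in sequentially. \<forall>w\<in>L. dist (F n w) (f w) < e * d / 2"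
      using ul unfolding uniform_limit_iff by blast
    then show "\<forall>\<^sub>F n in sequentially. \<forall>x\<in>K. dist (deriv (F n) x) (deriv f x) < e"
    proof eventually_elim
      case (elim n)
      show ?case
      proof
        fix x assume x: "x \<in> K"
        have sub: "cball x d \<subseteq> S" using d(2) x by blast
        have hol: "(\<lambda>w. F n w - f w) holomorphic_on S" by (intro holomorphic_intros F f)
        have "norm ((deriv ^^ 1) (\<lambda>w. F n w - f w) x) \<le> fact 1 * (e * d / 2) / d ^ 1"
        proof (rule Cauchy_inequality)
          show "(\<lambda>w. F n w - f w) holomorphic_on ball x d"
            using hol sub by (meson ball_subset_cball holomorphic_on_subset order_trans)
          show "continuous_on (cball x d) (\<lambda>w. F n w - f w)"
            using hol sub by (meson continuous_on_subset holomorphic_on_imp_continuous_on)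
          show "norm (F n w - f w) \<le> e * d / 2" if "norm (x - w) = d" for w
          proof -
            have "w \<in> cball x d" using that by (simp add: dist_norm)
            then show ?thesis using elim ballL[OF x] by (force simp: dist_norm)
          qed
        qed (rule d(1))
        moreover have "deriv (\<lambda>w. F n w - f w) x = deriv (F n) x - deriv f x"
          using F[of n] f S x K(2) by (intro deriv_diff) (auto intro: holomorphic_on_imp_differentiable_at)
        ultimately show "dist (deriv (F n) x) (deriv f x) < e" using d(1) e by (simp add: dist_norm)
      qed
    qed
  qed
qed

text \<open>
  Hurwitz's theorem for the derivatives. It says nothing about a constant limit, but a
  constant derivative can only vanish if the limit function is constant.
\<close>

lemma loc_univalent_limit:
  fixes F :: "nat \<Rightarrow> complex \<Rightarrow> complex"
  assumes S: "open S" "connected S" and F: "\<And>n. F n holomorphic_on S" and f: "f holomorphic_on S"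
    and nz: "\<And>n z. z \<in> S \<Longrightarrow> deriv (F n) z \<noteq> 0"
    and lim: "\<And>K. compact K \<Longrightarrow> K \<subseteq> S \<Longrightarrow> uniform_limit K F f sequentially"
    and nc: "\<not> f constant_on S" and z: "z \<in> S"
  shows "deriv f z \<noteq> 0"
proof (cases "deriv f constant_on S")
  case False
  show ?thesis
  proof (rule Hurwitz_no_zeros[of S "\<lambda>n. deriv (F n)" "deriv f"])
    show "deriv (F n) holomorphic_on S" for n by (rule holomorphic_deriv[OF F S(1)])
    show "deriv f holomorphic_on S" by (rule holomorphic_deriv[OF f S(1)])
    show "uniform_limit K (\<lambda>n. deriv (F n)) (deriv f) sequentially" if "compact K" "K \<subseteq> S" for K
      by (rule uniform_limit_deriv[OF S(1) F f lim that])
  qed (use S nz False z in auto)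
next
  case True
  then obtain c where c: "\<And>w. w \<in> S \<Longrightarrow> deriv f w = c" unfolding constant_on_def by blast
  have "c \<noteq> 0"
  proof
    assume "c = 0"
    then have "\<And>w. w \<in> S \<Longrightarrow> (f has_field_derivative 0) (at w)"
      using holomorphic_derivI[OF f S(1)] c by metis
    then have "f constant_on S"
      using has_field_derivative_0_imp_constant_on[of S f] S by blast
    then show False using nc by blast
  qed
  then show ?thesis using c z by simp
qed

text \<open>
  The inductive construction has states \<open>(F n, \<rho> n)\<close>. From stage \<open>n\<close> on, the values on
  \<open>cball 0 (\<rho> n)\<close> change by at most \<open>2 / 2\<^sup>n\<close> in total. The radius \<open>\<rho> (n + 1)\<close> is so
  large that the image of \<open>cball 0 (R n)\<close> under the automorphism of stage \<open>n\<close> is protected in this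
  way, and the approximation of \<open>E n\<close> that was reached at that stage survives in the limit.
\<close>

lemma disc_universal_function:
  obtains f where "f holomorphic_on ball 0 1" "\<And>z. z \<in> ball 0 1 \<Longrightarrow> norm (f z) \<le> 1"
    "\<And>z. z \<in> ball 0 1 \<Longrightarrow> deriv f z \<noteq> 0"
    "\<And>g r e. g holomorphic_on ball 0 1 \<Longrightarrow> (\<And>z. z \<in> ball 0 1 \<Longrightarrow> norm (g z) \<le> 1) \<Longrightarrow>
       (\<And>z. z \<in> ball 0 1 \<Longrightarrow> deriv g z \<noteq> 0) \<Longrightarrow> r < 1 \<Longrightarrow> e > 0 \<Longrightarrow>
       \<exists>\<phi>\<in>disc_auts. \<forall>z. norm z \<le> r \<longrightarrow> norm (f (\<phi> z) - g z) < e"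
proof -
  let ?D = "ball (0::complex) 1"
  obtain E :: "nat \<Rightarrow> complex \<Rightarrow> complex" where E: "range E \<subseteq> strict_loc_univalent"
    and dense: "\<forall>g\<in>strict_loc_univalent. \<forall>r<1. \<forall>e>0. \<forall>m. \<exists>n\<ge>m. \<forall>z. norm z \<le> r \<longrightarrow> norm (E n z - g z) < e"
    using strict_loc_univalent_recurrent_dense_sequence by blast
  define R where "R = (\<lambda>n::nat. 1 - 1 / real (Suc n))"
  define P where "P = (\<lambda>n (x :: (complex \<Rightarrow> complex) \<times> real).
      fst x \<in> strict_loc_univalent \<and> snd x < 1 \<and> R n \<le> snd x)"
  define Q where "Q = (\<lambda>n (x :: (complex \<Rightarrow> complex) \<times> real) (y :: (complex \<Rightarrow> complex) \<times> real).
      snd x \<le> snd y \<and> (\<forall>z. norm z \<le> snd x \<longrightarrow> norm (fst y z - fst x z) < (1/2) ^ n) \<and>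
      (\<exists>\<phi>\<in>disc_auts. \<forall>z. norm z \<le> R n \<longrightarrow> norm (fst y (\<phi> z) - E n z) < (1/2) ^ n \<and> norm (\<phi> z) \<le> snd y))"
  have Rlt: "R n < 1" for n by (simp add: R_def)
  have "\<exists>X. \<forall>n. P n (X n) \<and> Q n (X n) (X (Suc n))"
  proof (rule dependent_nat_choice)
    show "\<exists>x. P 0 x"
      using E Rlt[of 0] by (intro exI[of _ "(E 0, R 0)"]) (auto simp: P_def)
    fix x n assume "P n x"
    then have x: "fst x \<in> strict_loc_univalent" "snd x < 1" "R n \<le> snd x" by (auto simp: P_def)
    have En: "E n \<in> strict_loc_univalent" using E by blast
    obtain f \<phi> where f: "f \<in> strict_loc_univalent" "\<phi> \<in> disc_auts"
      "\<And>z. norm z \<le> snd x \<Longrightarrow> norm (f z - fst x z) < (1/2) ^ n"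
      "\<And>z. norm z \<le> snd x \<Longrightarrow> norm (f (\<phi> z) - E n z) < (1/2) ^ n"
      using approximate_two_functions[OF x(1) En x(2), of "(1/2) ^ n"] by auto
    obtain r' where r': "r' < 1" "\<And>z. norm z \<le> R n \<Longrightarrow> norm (\<phi> z) \<le> r'"
      using disc_aut_image_bound[OF f(2) Rlt] by metis
    define \<rho> where "\<rho> = max (snd x) (max r' (R (Suc n)))"
    have "\<rho> < 1" "R (Suc n) \<le> \<rho>" "snd x \<le> \<rho>" "r' \<le> \<rho>"
      using x r' Rlt[of "Suc n"] by (auto simp: \<rho>_def)
    then have "P (Suc n) (f, \<rho>)" using f by (simp add: P_def)
    moreover have "Q n x (f, \<rho>)"
      unfolding Q_def
    proof (intro conjI allI impI bexI[of _ \<phi>])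
      fix z :: complex assume z: "norm z \<le> R n"
      show "norm (fst (f, \<rho>) (\<phi> z) - E n z) < (1/2) ^ n"
        using f(4)[of z] z x(3) by simp
      show "norm (\<phi> z) \<le> snd (f, \<rho>)" using r'(2)[OF z] \<open>r' \<le> \<rho>\<close> by simp
    qed (use f \<open>snd x \<le> \<rho>\<close> in auto)
    ultimately show "\<exists>y. P (Suc n) y \<and> Q n x y" by blast
  qed
  then obtain X where X: "\<And>n. P n (X n)" "\<And>n. Q n (X n) (X (Suc n))" by blast
  define F where "F = (\<lambda>n. fst (X n))"
  define \<rho> where "\<rho> = (\<lambda>n. snd (X n))"
  have F: "F n \<in> strict_loc_univalent" and \<rho>: "\<rho> n < 1" "R n \<le> \<rho> n" for n
    using X(1)[of n] by (auto simp: P_def F_def \<rho>_def)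
  have \<rho>_mono: "\<rho> m \<le> \<rho> n" if "m \<le> n" for m n
    using that by (rule lift_Suc_mono_le[rotated]) (use X(2) in \<open>auto simp: Q_def \<rho>_def\<close>)
  have step: "norm (F (Suc n) z - F n z) < (1/2) ^ n" if "norm z \<le> \<rho> n" for n z
    using X(2)[of n] that by (auto simp: Q_def F_def \<rho>_def)
  have hit: "\<exists>\<phi>\<in>disc_auts. \<forall>z. norm z \<le> R n \<longrightarrow> norm (F (Suc n) (\<phi> z) - E n z) < (1/2) ^ n \<and> norm (\<phi> z) \<le> \<rho> (Suc n)" for n
    using X(2)[of n] by (auto simp: Q_def F_def \<rho>_def)
  have tele: "norm (F (n + k) z - F n z) \<le> 2 * (1/2) ^ n - 2 * (1/2) ^ (n + k)" if "norm z \<le> \<rho> n" for n k z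
  proof (induction k)
    case (Suc k)
    have "norm z \<le> \<rho> (n + k)" using that \<rho>_mono[of n "n + k"] by simp
    then have "norm (F (Suc (n + k)) z - F (n + k) z) < (1/2) ^ (n + k)" by (rule step)
    moreover have "norm (F (n + Suc k) z - F n z) \<le> norm (F (Suc (n + k)) z - F (n + k) z) + norm (F (n + k) z - F n z)"
      using norm_triangle_ineq[of "F (Suc (n + k)) z - F (n + k) z" "F (n + k) z - F n z"] by simp
    moreover have "2 * (1/2::real) ^ (n + Suc k) = (1/2) ^ (n + k)" by simp
    ultimately show ?case using Suc.IH by linarith
  qed simp
  have R_large: "\<exists>n. r \<le> R n \<and> (1/2) ^ n < e" if "r < 1" "e > 0" for r e :: real
  proof -
    have "0 < 1 - r" using that by simp
    then obtain n1 where n1: "1 / real (Suc n1) < 1 - r" by (rule nat_approx_posE)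
    have "\<exists>n. (1/2) ^ n < e" by (rule real_arch_pow_inv) (use that in auto)
    then obtain n2 where n2: "(1/2) ^ n2 < e" by blast
    define n where "n = max n1 n2"
    have "1 / real (Suc n) \<le> 1 / real (Suc n1)" by (simp add: n_def frac_le)
    moreover have "(1/2::real) ^ n \<le> (1/2) ^ n2" by (intro power_decreasing) (auto simp: n_def)
    ultimately have "r \<le> R n" "(1/2) ^ n < e" using n1 n2 unfolding R_def by linarith+
    then show ?thesis by blast
  qed
  have pow_le: "(1/2::real) ^ n \<le> (1/2) ^ m" if "m \<le> n" for m n using that by (intro power_decreasing) auto
  define f where "f = (\<lambda>z. lim (\<lambda>n. F n z))"
  have tends: "(\<lambda>n. F n z) \<longlonglongrightarrow> f z" if z: "norm z < 1" for z
  proof -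
    have "Cauchy (\<lambda>n. F n z)"
    proof (rule metric_CauchyI)
      fix e :: real assume "e > 0"
      then obtain n where n: "norm z \<le> R n" "(1/2) ^ n < e / 4" using R_large[OF z, of "e / 4"] by auto
      have "norm z \<le> \<rho> n" using n \<rho>(2)[of n] by simp
      then have *: "norm (F m z - F n z) < e / 2" if "m \<ge> n" for m
      proof -
        have "norm (F m z - F n z) \<le> 2 * (1/2) ^ n - 2 * (1/2) ^ m"
          using tele[OF \<open>norm z \<le> \<rho> n\<close>, of "m - n"] that by simp
        moreover have "0 \<le> (1/2::real) ^ m" by simp
        ultimately show ?thesis using n(2) by linarith
      qed
      have "dist (F a z) (F b z) < e" if "a \<ge> n" "b \<ge> n" for a b
        using *[OF that(1)] *[OF that(2)] by (metis dist_norm dist_triangle_half_l)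
      then show "\<exists>M. \<forall>m\<ge>M. \<forall>n\<ge>M. dist (F m z) (F n z) < e" by blast
    qed
    then show ?thesis unfolding f_def by (simp add: Cauchy_convergent_iff convergent_LIMSEQ_iff)
  qed
  have close: "norm (F n z - f z) \<le> 2 * (1/2) ^ n" if z: "norm z \<le> \<rho> n" for n z
  proof -
    have "norm z < 1" using z \<rho>(1)[of n] by simp
    from tends[OF this] have "(\<lambda>k. F (n + k) z) \<longlonglongrightarrow> f z" by (subst add.commute) (rule LIMSEQ_ignore_initial_segment)
    then have "(\<lambda>k. norm (F (n + k) z - F n z)) \<longlonglongrightarrow> norm (f z - F n z)" by (intro tendsto_intros)
    moreover have "norm (F (n + k) z - F n z) \<le> 2 * (1/2) ^ n" for k
      using tele[OF z, of k] zero_le_power[of "1/2::real" "n + k"] by linarith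
    ultimately have "norm (f z - F n z) \<le> 2 * (1/2) ^ n" by (intro LIMSEQ_le_const2) auto
    then show ?thesis by (simp add: norm_minus_commute)
  qed
  have ul: "uniform_limit K F f sequentially" if K: "compact K" "K \<subseteq> ?D" for K
  proof -
    obtain r where r: "r < 1" "K \<subseteq> cball 0 r"
    proof (cases "K = {}")
      case False
      then obtain x where "x \<in> K" "\<forall>y\<in>K. norm y \<le> norm x"
        using continuous_attains_sup[of K norm] K(1) by (metis continuous_on_norm_id)
      then show ?thesis using that[of "norm x"] K(2) by force
    qed (use that[of 0] in simp)
    show ?thesis
      unfolding uniform_limit_iff
    proof (intro allI impI)
      fix e :: real assume "e > 0"
      then obtain n where n: "r \<le> R n" "(1/2) ^ n < e / 2" using R_large[OF r(1), of "e / 2"] by auto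
      have "dist (F m z) (f z) < e" if "m \<ge> n" "z \<in> K" for m z
      proof -
        have "norm z \<le> \<rho> m" using that r(2) n(1) \<rho>(2)[of n] \<rho>_mono[OF that(1)] by force
        from close[OF this] show ?thesis
          using n(2) pow_le[OF that(1)] unfolding dist_norm by linarith
      qed
      then show "\<forall>\<^sub>F n in sequentially. \<forall>z\<in>K. dist (F n z) (f z) < e"
        by (auto simp: eventually_sequentially)
    qed
  qed
  have holF: "F n holomorphic_on ?D" for n by (rule strict_loc_univalent_holomorphic[OF F])
  have holf: "f holomorphic_on ?D"
  proof (rule holomorphic_uniform_sequence[OF open_ball holF])
    fix x assume "x \<in> ?D"
    then have "\<exists>d>0. cball x d \<subseteq> ?D"
      by (rule bspec[OF open_contains_cball[THEN iffD1, OF open_ball]])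
    then obtain d where d: "d > 0" "cball x d \<subseteq> ?D" by blast
    have "uniform_limit (cball x d) F f sequentially" by (rule ul[OF compact_cball d(2)])
    with d show "\<exists>d>0. cball x d \<subseteq> ?D \<and> uniform_limit (cball x d) F f sequentially" by blast
  qed
  have bound: "norm (f z) \<le> 1" if "z \<in> ?D" for z
  proof (rule LIMSEQ_le_const2)
    show "(\<lambda>n. norm (F n z)) \<longlonglongrightarrow> norm (f z)" using tends that by (intro tendsto_norm) simp
    have "norm (F n z) \<le> 1" for n using F[of n] that unfolding strict_loc_univalent_def by (auto simp: less_imp_le)
    then show "\<exists>N. \<forall>n\<ge>N. norm (F n z) \<le> 1" by blast
  qed
  have univ: "\<exists>\<phi>\<in>disc_auts. \<forall>z. norm z \<le> r \<longrightarrow> norm (f (\<phi> z) - g z) < e"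
    if g: "g holomorphic_on ?D" "\<And>z. z \<in> ?D \<Longrightarrow> norm (g z) \<le> 1" "\<And>z. z \<in> ?D \<Longrightarrow> deriv g z \<noteq> 0"
      and r: "r < 1" and e: "e > 0" for g r e
  proof -
    have e3: "e / 3 > 0" using e by simp
    obtain h where h: "h \<in> strict_loc_univalent" "\<And>z. norm z \<le> r \<Longrightarrow> norm (h z - g z) < e / 3"
      using strict_loc_univalent_approximates[OF g r e3] by blast
    obtain m where m: "r \<le> R m" "(1/2) ^ m < e / 6" using R_large[OF r, of "e / 6"] e by auto
    obtain n where n: "n \<ge> m" "\<And>z. norm z \<le> r \<Longrightarrow> norm (E n z - h z) < e / 3"
      using dense h(1) r e3 by meson
    have "R m \<le> R n" using n(1) by (simp add: R_def frac_le)
    then have rn: "r \<le> R n" using m(1) by simp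
    have pn: "(1/2) ^ n < e / 6" using m(2) pow_le[OF n(1)] by linarith
    obtain \<phi> where \<phi>: "\<phi> \<in> disc_auts"
      "\<And>z. norm z \<le> R n \<Longrightarrow> norm (F (Suc n) (\<phi> z) - E n z) < (1/2) ^ n \<and> norm (\<phi> z) \<le> \<rho> (Suc n)"
      using hit[of n] by blast
    have "norm (f (\<phi> z) - g z) < e" if z: "norm z \<le> r" for z
    proof -
      have 1: "norm (F (Suc n) (\<phi> z) - E n z) < (1/2) ^ n" "norm (\<phi> z) \<le> \<rho> (Suc n)"
        using \<phi>(2)[of z] z rn by auto
      have 2: "norm (F (Suc n) (\<phi> z) - f (\<phi> z)) \<le> (1/2) ^ n" using close[OF 1(2)] by simp
      have "f (\<phi> z) - g z = - (F (Suc n) (\<phi> z) - f (\<phi> z)) + (F (Suc n) (\<phi> z) - E n z) + (E n z - h z) + (h z - g z)"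
        by simp
      then have "norm (f (\<phi> z) - g z) \<le> norm (F (Suc n) (\<phi> z) - f (\<phi> z)) + norm (F (Suc n) (\<phi> z) - E n z)
          + norm (E n z - h z) + norm (h z - g z)"
        by (metis norm_triangle_ineq norm_minus_cancel norm_triangle_le add_right_mono)
      then show ?thesis using 1 2 n(2)[OF z] h(2)[OF z] pn by linarith
    qed
    then show ?thesis using \<phi>(1) by blast
  qed
  \<comment> \<open>A constant cannot be close both to \<open>0\<close> and to \<open>1/4\<close>, two values of \<open>z / 2\<close>, which is one of the functions to be approximated.\<close>
  have nonconst: "\<not> f constant_on ?D"
  proof
    assume "f constant_on ?D"
    then obtain c where c: "\<And>z. z \<in> ?D \<Longrightarrow> f z = c" unfolding constant_on_def by blast
    have d: "((\<lambda>z::complex. z / 2) has_field_derivative 1 / 2) (at z)" for z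
      by (auto intro!: derivative_eq_intros)
    have "\<exists>\<phi>\<in>disc_auts. \<forall>z. norm z \<le> 1/2 \<longrightarrow> norm (f (\<phi> z) - z / 2) < 1/8"
      by (rule univ) (auto intro!: holomorphic_intros simp: DERIV_imp_deriv[OF d] norm_divide)
    then obtain \<phi> where \<phi>: "\<phi> \<in> disc_auts" "\<And>z. norm z \<le> 1/2 \<Longrightarrow> norm (f (\<phi> z) - z / 2) < 1/8" by blast
    have "f (\<phi> z) = c" if "norm z \<le> 1/2" for z
      using \<phi>(1) that by (intro c) (auto simp: disc_auts_def)
    then have "norm (c - 0) < 1/8" "norm (c - 1/4) < 1/8"
      using \<phi>(2)[of 0] \<phi>(2)[of "1/2"] by (auto simp: norm_divide)
    then have "norm ((1/4) :: complex) < 1/4"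
      using norm_triangle_ineq4[of "c - 0" "c - 1/4"] by simp
    then show False by (simp add: norm_divide)
  qed
  have "deriv f z \<noteq> 0" if "z \<in> ?D" for z
  proof (rule loc_univalent_limit[OF open_ball connected_ball holF holf _ ul nonconst that])
    show "deriv (F n) z \<noteq> 0" if "z \<in> ?D" for n z
      using F[of n] that unfolding strict_loc_univalent_def by auto
  qed
  with holf bound univ show ?thesis using that[of f] by blast
qed

section \<open>Transport to simply connected domains\<close>

text \<open>
  A holomorphic left inverse \<open>\<eta>\<close> forces \<open>\<psi>' \<noteq> 0\<close>. The lemma serves both for the Riemann map
  and its inverse and for the automorphisms of a single domain.
\<close>

lemma bounded_loc_univalent_compose:
  assumes S: "open S" and D: "open D" and f: "f \<in> bounded_loc_univalent D"
    and \<psi>: "\<psi> holomorphic_on S" "\<And>z. z \<in> S \<Longrightarrow> \<psi> z \<in> D"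
    and \<eta>: "\<eta> holomorphic_on D" "\<And>z. z \<in> S \<Longrightarrow> \<eta> (\<psi> z) = z"
  shows "(\<lambda>z\<in>S. f (\<psi> z)) \<in> bounded_loc_univalent S"
proof -
  have f': "f holomorphic_on D" "\<And>z. z \<in> D \<Longrightarrow> norm (f z) \<le> 1" "\<And>z. z \<in> D \<Longrightarrow> deriv f z \<noteq> 0"
    using f by (auto simp: bounded_loc_univalent_def)
  have d: "((\<lambda>z\<in>S. f (\<psi> z)) has_field_derivative deriv f (\<psi> z) * deriv \<psi> z) (at z)" if z: "z \<in> S" for z
  proof -
    have "((\<lambda>z. f (\<psi> z)) has_field_derivative deriv f (\<psi> z) * deriv \<psi> z) (at z)"
      by (rule DERIV_chain2[OF holomorphic_derivI[OF f'(1) D \<psi>(2)[OF z]] holomorphic_derivI[OF \<psi>(1) S z]])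
    then show ?thesis
      by (rule has_field_derivative_transform_within_open[OF _ S z]) simp
  qed
  have "deriv \<psi> z \<noteq> 0" if z: "z \<in> S" for z
  proof
    assume "deriv \<psi> z = 0"
    moreover have "((\<lambda>z. \<eta> (\<psi> z)) has_field_derivative deriv \<eta> (\<psi> z) * deriv \<psi> z) (at z)"
      by (rule DERIV_chain2[OF holomorphic_derivI[OF \<eta>(1) D \<psi>(2)[OF z]] holomorphic_derivI[OF \<psi>(1) S z]])
    ultimately have "((\<lambda>z. \<eta> (\<psi> z)) has_field_derivative 0) (at z)" by simp
    then have "((\<lambda>z. z) has_field_derivative 0) (at z)"
      by (rule has_field_derivative_transform_within_open[OF _ S z]) (simp add: \<eta>(2))
    then show False using DERIV_unique[OF _ DERIV_ident] by force
  qed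
  then have "deriv (\<lambda>z\<in>S. f (\<psi> z)) z \<noteq> 0" if "z \<in> S" for z
    using DERIV_imp_deriv[OF d[OF that]] f'(3)[OF \<psi>(2)[OF that]] that by simp
  moreover have "(\<lambda>z\<in>S. f (\<psi> z)) holomorphic_on S"
    using d by (meson holomorphic_onI field_differentiable_at_within field_differentiable_def)
  ultimately show ?thesis using f'(2) \<psi>(2) by (simp add: bounded_loc_univalent_def)
qed

lemma conformal_Aut_transport:
  assumes \<psi>: "\<psi> holomorphic_on S" "\<And>z. z \<in> S \<Longrightarrow> \<psi> z \<in> ball 0 1"
    and \<eta>: "\<eta> holomorphic_on ball 0 1" "\<And>z. z \<in> ball 0 1 \<Longrightarrow> \<eta> z \<in> S"
    and inv: "\<And>z. z \<in> S \<Longrightarrow> \<eta> (\<psi> z) = z" "\<And>z. z \<in> ball 0 1 \<Longrightarrow> \<psi> (\<eta> z) = z"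
    and \<phi>: "\<phi> \<in> disc_auts"
  shows "(\<lambda>z\<in>S. \<eta> (\<phi> (\<psi> z))) \<in> conformal_Aut S"
proof -
  let ?D = "ball (0::complex) 1"
  obtain \<kappa> where \<kappa>: "\<phi> holomorphic_on ?D" "\<forall>z\<in>?D. \<phi> z \<in> ?D" "\<kappa> holomorphic_on ?D" "\<forall>z\<in>?D. \<kappa> z \<in> ?D"
      "\<forall>z\<in>?D. \<kappa> (\<phi> z) = z \<and> \<phi> (\<kappa> z) = z"
    using \<phi> unfolding disc_auts_def by blast
  have hol: "(\<lambda>z. \<eta> (\<theta> (\<psi> z))) holomorphic_on S"
    if \<theta>: "\<theta> holomorphic_on ?D" "\<forall>z\<in>?D. \<theta> z \<in> ?D" for \<theta>
  proof -
    have "(\<theta> \<circ> \<psi>) holomorphic_on S"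
      using \<psi> \<theta> by (intro holomorphic_on_compose_gen[of _ _ _ ?D]) auto
    then have "(\<eta> \<circ> (\<theta> \<circ> \<psi>)) holomorphic_on S"
      by (rule holomorphic_on_compose_gen[OF _ \<eta>(1)]) (use \<psi> \<theta> in auto)
    then show ?thesis by (simp add: o_def)
  qed
  define p where "p = (\<lambda>z\<in>S. \<eta> (\<phi> (\<psi> z)))"
  define q where "q = (\<lambda>z. \<eta> (\<kappa> (\<psi> z)))"
  have pS: "p z \<in> S" "q z \<in> S" "q (p z) = z" "p (q z) = z" if "z \<in> S" for z
    using that \<psi> \<eta> inv \<kappa> by (simp_all add: p_def q_def)
  have bij: "bij_betw p S S"
    by (rule bij_betw_byWitness[of _ q]) (use pS in auto)
  have "inv_into S p z = q z" if "z \<in> S" for z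
    using bij pS that by (intro inv_into_f_eq) (auto simp: bij_betw_def)
  moreover have "q holomorphic_on S" unfolding q_def by (rule hol[OF \<kappa>(3,4)])
  ultimately have "inv_into S p holomorphic_on S" by (metis holomorphic_transform)
  moreover have "p holomorphic_on S"
    by (rule holomorphic_transform[OF hol[OF \<kappa>(1,2)]]) (simp add: p_def)
  ultimately show ?thesis using bij by (simp add: conformal_Aut_def p_def)
qed

theorem theorem1p5:
  fixes \<Omega> :: "complex set"
  assumes "open \<Omega>" and "connected \<Omega>" and "\<Omega> \<noteq> {}"
    and "simply_connected \<Omega>" and "\<Omega> \<noteq> UNIV"
  shows "\<exists>f \<in> bounded_loc_univalent \<Omega>.
    dense_subset_of (bounded_loc_univalent_topology \<Omega>)
      {compose \<Omega> f \<phi> | \<phi>. \<phi> \<in> conformal_Aut \<Omega>}"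
proof -
  let ?D = "ball (0::complex) 1"
  obtain \<psi> \<eta> where \<psi>: "\<psi> holomorphic_on \<Omega>" "\<And>z. z \<in> \<Omega> \<Longrightarrow> \<psi> z \<in> ?D"
    and \<eta>: "\<eta> holomorphic_on ?D" "\<And>z. z \<in> ?D \<Longrightarrow> \<eta> z \<in> \<Omega>"
    and inv: "\<And>z. z \<in> \<Omega> \<Longrightarrow> \<eta> (\<psi> z) = z" "\<And>z. z \<in> ?D \<Longrightarrow> \<psi> (\<eta> z) = z"
    using Riemann_mapping_theorem[of \<Omega>] assms by metis
  obtain f where f: "f holomorphic_on ?D" "\<And>z. z \<in> ?D \<Longrightarrow> norm (f z) \<le> 1"
    "\<And>z. z \<in> ?D \<Longrightarrow> deriv f z \<noteq> 0"
    and univ: "\<And>g r e. g holomorphic_on ?D \<Longrightarrow> (\<And>z. z \<in> ?D \<Longrightarrow> norm (g z) \<le> 1) \<Longrightarrow>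
       (\<And>z. z \<in> ?D \<Longrightarrow> deriv g z \<noteq> 0) \<Longrightarrow> r < 1 \<Longrightarrow> e > 0 \<Longrightarrow>
       \<exists>\<phi>\<in>disc_auts. \<forall>z. norm z \<le> r \<longrightarrow> norm (f (\<phi> z) - g z) < e"
    using disc_universal_function by blast
  define fD where "fD = (\<lambda>z\<in>?D. f z)"
  have fD: "fD \<in> bounded_loc_univalent ?D"
  proof -
    have "deriv fD z = deriv f z" if "z \<in> ?D" for z
      using that eventually_nhds_in_open[OF open_ball that]
      by (intro deriv_cong_ev) (auto simp: fD_def elim!: eventually_mono)
    moreover have "fD holomorphic_on ?D"
      by (rule holomorphic_transform[OF f(1)]) (simp add: fD_def)
    ultimately show ?thesis using f(2,3) by (simp add: bounded_loc_univalent_def) (simp add: fD_def)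
  qed
  define F where "F = (\<lambda>z\<in>\<Omega>. fD (\<psi> z))"
  have F: "F \<in> bounded_loc_univalent \<Omega>"
    unfolding F_def by (rule bounded_loc_univalent_compose[OF assms(1) open_ball fD \<psi> \<eta>(1) inv(1)])
  define \<O> where "\<O> = {compose \<Omega> F \<phi> | \<phi>. \<phi> \<in> conformal_Aut \<Omega>}"
  have sub: "\<O> \<subseteq> bounded_loc_univalent \<Omega>"
  proof
    fix G assume "G \<in> \<O>"
    then obtain \<phi> where \<phi>: "\<phi> \<in> conformal_Aut \<Omega>" "G = compose \<Omega> F \<phi>" by (auto simp: \<O>_def)
    have "(\<lambda>z\<in>\<Omega>. F (\<phi> z)) \<in> bounded_loc_univalent \<Omega>"
      by (rule bounded_loc_univalent_compose[OF assms(1,1) F, of _ "inv_into \<Omega> \<phi>"])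
        (use \<phi>(1) in \<open>auto simp: conformal_Aut_def bij_betw_def\<close>)
    then show "G \<in> bounded_loc_univalent \<Omega>" by (simp add: \<phi>(2) compose_def)
  qed
  have "bounded_loc_univalent \<Omega> \<subseteq> bounded_loc_univalent_topology \<Omega> closure_of \<O>"
  proof
    fix G assume G: "G \<in> bounded_loc_univalent \<Omega>"
    have "\<exists>H\<in>\<O>. H \<in> T" if T: "G \<in> T" "openin (bounded_loc_univalent_topology \<Omega>) T" for T
    proof -
      obtain T' where T': "openin (locally_uniform_topology \<Omega>) T'" "T = T' \<inter> bounded_loc_univalent \<Omega>"
        using T(2) unfolding bounded_loc_univalent_topology_def openin_subtopology by blast
      then obtain K e where K: "compact K" "K \<subseteq> \<Omega>" "0 < e"
          "{g \<in> extensional \<Omega>. \<forall>z\<in>K. dist (g z) (G z) < e} \<subseteq> T'"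
        using T(1) unfolding openin_locally_uniform_topology by blast
      obtain r where r: "r < 1" "\<And>z. z \<in> K \<Longrightarrow> norm (\<psi> z) \<le> r"
      proof (cases "K = {}")
        case False
        have "continuous_on K (\<lambda>z. norm (\<psi> z))"
          using \<psi>(1) K(2) by (intro continuous_on_norm) (meson continuous_on_subset holomorphic_on_imp_continuous_on)
        then obtain x where "x \<in> K" "\<forall>y\<in>K. norm (\<psi> y) \<le> norm (\<psi> x)"
          using continuous_attains_sup[of K] K(1) False by blast
        then show ?thesis using that[of "norm (\<psi> x)"] K(2) \<psi>(2) by force
      qed (use that[of 0] in simp)
      define g where "g = (\<lambda>z\<in>?D. G (\<eta> z))"
      have "g \<in> bounded_loc_univalent ?D"
        unfolding g_def by (rule bounded_loc_univalent_compose[OF open_ball assms(1) G \<eta> \<psi>(1) inv(2)])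
      then obtain \<phi> where \<phi>: "\<phi> \<in> disc_auts" "\<And>z. norm z \<le> r \<Longrightarrow> norm (f (\<phi> z) - g z) < e"
        using univ[of g r e] r(1) K(3) by (auto simp: bounded_loc_univalent_def)
      define H where "H = compose \<Omega> F (\<lambda>z\<in>\<Omega>. \<eta> (\<phi> (\<psi> z)))"
      have H: "H \<in> \<O>"
        unfolding \<O>_def H_def using conformal_Aut_transport[OF \<psi> \<eta> inv \<phi>(1)] by blast
      moreover have "dist (H z) (G z) < e" if z: "z \<in> K" for z
      proof -
        have z\<Omega>: "z \<in> \<Omega>" using z K(2) by blast
        have \<phi>D: "\<phi> (\<psi> z) \<in> ?D" using \<phi>(1) \<psi>(2)[OF z\<Omega>] by (auto simp: disc_auts_def)
        have "H z = f (\<phi> (\<psi> z))"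
          using z\<Omega> \<phi>D \<eta>(2)[OF \<phi>D] inv(2)[OF \<phi>D] by (simp add: H_def F_def fD_def compose_def)
        moreover have "g (\<psi> z) = G z" using \<psi>(2)[OF z\<Omega>] inv(1)[OF z\<Omega>] by (simp add: g_def)
        ultimately show ?thesis using \<phi>(2)[OF r(2)[OF z]] by (simp add: dist_norm)
      qed
      moreover have "H \<in> bounded_loc_univalent \<Omega>" using H sub by blast
      moreover have "H \<in> extensional \<Omega>" by (simp add: H_def)
      ultimately show ?thesis using K(4) T'(2) by blast
    qed
    then show "G \<in> bounded_loc_univalent_topology \<Omega> closure_of \<O>"
      using G by (fastforce simp: in_closure_of)
  qed
  moreover have "bounded_loc_univalent_topology \<Omega> closure_of \<O> \<subseteq> bounded_loc_univalent \<Omega>"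
    using closure_of_subset_topspace[of "bounded_loc_univalent_topology \<Omega>"] by simp
  ultimately have "dense_subset_of (bounded_loc_univalent_topology \<Omega>) \<O>"
    using sub by (simp add: dense_subset_of_def)
  then show ?thesis using F unfolding \<O>_def by blast
qed

end
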